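(* Let $G=P_2\boxtimes P_r$ be the strong product of the path graphs $P_2$ and $P_r$, and let $\mathbf{k}=\mathbf{2}=(2,\ldots,2)\in\mathbb{N}^{2r}$. Then $$\operatorname{proj\,dim}(S/\mathrm{NI}_{\mathbf{k}}(G))\ge 2r-\left\lceil\frac{r}{3}\right\rceil\qquad\text{and}\qquad\operatorname{depth}(S/\mathrm{NI}_{\mathbf{k}}(G))\le\left\lceil\frac{r}{3}\right\rceil.$$
   Context: $P_2\boxtimes P_r$ is the graph with vertex set $\{x_1,\ldots,x_r,y_1,\ldots,y_r\}$ and edge set $\{\{x_i,x_{i+1}\},\{x_i,y_{i+1}\},\{y_i,y_{i+1}\},\{y_i,x_{i+1}\}:1\le i<r\}\cup\{\{x_i,y_i\}:1\le i\le r\}$. $K$ is a field and $S$ is the polynomial ring over $K$ whose $2r$ variables are the vertices of $G$. $N_G[v]$ is the closed neighborhood of a vertex $v$. For $\mathbf{k}=(k_v)_{v\in V(G)}$ with $1\le k_v\le\deg_G(v)+1$, the $\mathbf{k}$-neighborhood ideal $\mathrm{NI}_{\mathbf{k}}(G)\subseteq S$ is generated by the squarefree monomials $\prod_{w\in W}w$ for all $W$ such that $W\subseteq N_G[v]$ and $|W|=k_v$ for some vertex $v$. *)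

theory Defs
  imports
    Complex_Main
    "HOL-Library.Extended_Nat"
    "HOL-Library.Poly_Mapping"
    "HOL-Algebra.QuotRing"
    "HOL-Algebra.Module"
begin

section \<open>Polynomial rings\<close>

text \<open>
  A polynomial is a finitely supported map from exponent vectors
  (finitely supported maps from variables to \<^typ>\<open>nat\<close>) to coefficients; the ring operations are
  those of \<^theory>\<open>HOL-Library.Poly_Mapping\<close>.  The variables range over a set rather than a type, so that
  their number may be a parameter of a statement.
\<close>

type_synonym ('v, 'k) mpoly = "('v \<Rightarrow>\<^sub>0 nat) \<Rightarrow>\<^sub>0 'k"

definition mpoly_ring :: "'v set \<Rightarrow> ('v, 'k::field) mpoly ring" where
  "mpoly_ring V =
     \<lparr>carrier = {p. \<forall>t\<in>Poly_Mapping.keys p. Poly_Mapping.keys t \<subseteq> V},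
      mult = (*), one = 1, zero = 0, add = (+)\<rparr>"

definition var :: "'v \<Rightarrow> ('v, 'k::field) mpoly" where
  "var v = Poly_Mapping.single (Poly_Mapping.single v 1) 1"


section \<open>Neighborhood ideals\<close>

text \<open>A graph is given by its vertex set \<open>V\<close> and its set \<open>E\<close> of edges, which are two-element sets.\<close>

definition closed_neighborhood :: "'v set \<Rightarrow> 'v set set \<Rightarrow> 'v \<Rightarrow> 'v set" where
  "closed_neighborhood V E v = {w \<in> V. w = v \<or> {v, w} \<in> E}"

definition neighborhood_ideal ::
    "'v set \<Rightarrow> 'v set set \<Rightarrow> ('v \<Rightarrow> nat) \<Rightarrow> ('v, 'k::field) mpoly set" where
  "neighborhood_ideal V E k =
     genideal (mpoly_ring V)
       {\<Prod>w\<in>W. var w |W. \<exists>v\<in>V. W \<subseteq> closed_neighborhood V E v \<and> card W = k v}"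

datatype ladder_vertex = X nat | Y nat

definition strong_ladder_verts :: "nat \<Rightarrow> ladder_vertex set" where
  "strong_ladder_verts r = X ` {1..r} \<union> Y ` {1..r}"

definition strong_ladder_edges :: "nat \<Rightarrow> ladder_vertex set set" where
  "strong_ladder_edges r =
     (\<Union>i\<in>{1..<r}. {{X i, X (i + 1)}, {X i, Y (i + 1)}, {Y i, Y (i + 1)}, {Y i, X (i + 1)}})
     \<union> {{X i, Y i} |i. i \<in> {1..r}}"


section \<open>Modules\<close>

text \<open>
  The library's \<^typ>\<open>('r, 'm) module\<close> extends the record of rings; for a module that is not an algebra
  the fields \<^const>\<open>mult\<close> and \<^const>\<open>one\<close> carry no meaning.
\<close>

definition quotient_module :: "('r, 'x) ring_scheme \<Rightarrow> 'r set \<Rightarrow> ('r, 'r set) module" where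
  "quotient_module R I =
     ring.extend (R Quot I) \<lparr>smult = (\<lambda>a C. (I +>\<^bsub>R\<^esub> a) \<otimes>\<^bsub>R Quot I\<^esub> C)\<rparr>"

definition module_hom ::
    "('r, 'x) ring_scheme \<Rightarrow> ('r, 'm, 'y) module_scheme \<Rightarrow> ('r, 'n, 'z) module_scheme \<Rightarrow> ('m \<Rightarrow> 'n) set" where
  "module_hom R M N =
     {h \<in> carrier M \<rightarrow> carrier N.
        (\<forall>x\<in>carrier M. \<forall>y\<in>carrier M. h (x \<oplus>\<^bsub>M\<^esub> y) = h x \<oplus>\<^bsub>N\<^esub> h y) \<and>
        (\<forall>a\<in>carrier R. \<forall>x\<in>carrier M. h (a \<odot>\<^bsub>M\<^esub> x) = a \<odot>\<^bsub>N\<^esub> h x)}"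

definition free_module :: "('r, 'x) ring_scheme \<Rightarrow> 'b set \<Rightarrow> ('r, 'b \<Rightarrow> 'r) module" where
  "free_module R B =
     \<lparr>carrier = {f. (\<forall>b. f b \<in> carrier R) \<and> finite {b. f b \<noteq> \<zero>\<^bsub>R\<^esub>} \<and> {b. f b \<noteq> \<zero>\<^bsub>R\<^esub>} \<subseteq> B},
      mult = undefined, one = undefined,
      zero = (\<lambda>b. \<zero>\<^bsub>R\<^esub>), add = (\<lambda>f g b. f b \<oplus>\<^bsub>R\<^esub> g b),
      smult = (\<lambda>a f b. a \<otimes>\<^bsub>R\<^esub> f b)\<rparr>"

text \<open>
  A module is projective if it is (isomorphic to) a direct summand of a free module, that is, if the identity of
  \<open>P\<close> factors through a free module.  A basis \<open>B\<close> of the type of elements of \<open>P\<close> is no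
  restriction: a direct summand of any free module is a direct summand of the free module on \<open>carrier P\<close>.
\<close>

definition projective_module :: "('r, 'x) ring_scheme \<Rightarrow> ('r, 'u, 'y) module_scheme \<Rightarrow> bool" where
  "projective_module R P \<longleftrightarrow> module R P \<and>
     (\<exists>(B :: 'u set) i p. i \<in> module_hom R P (free_module R B) \<and> p \<in> module_hom R (free_module R B) P \<and>
        (\<forall>x\<in>carrier P. p (i x) = x))"

text \<open>
  \<open>\<cdots> \<rightarrow> 0 \<rightarrow> P n \<rightarrow> \<cdots> \<rightarrow> P 1 \<rightarrow> P 0 \<rightarrow> M \<rightarrow> 0\<close> is exact, with \<open>d i\<close> mapping \<open>P (i + 1)\<close> to \<open>P i\<close>
  and \<open>e\<close> mapping \<open>P 0\<close> to \<open>M\<close>.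
\<close>

definition projective_resolution ::
    "('r, 'x) ring_scheme \<Rightarrow> ('r, 'm, 'y) module_scheme \<Rightarrow> nat \<Rightarrow>
     (nat \<Rightarrow> ('r, 'u) module) \<Rightarrow> (nat \<Rightarrow> 'u \<Rightarrow> 'u) \<Rightarrow> ('u \<Rightarrow> 'm) \<Rightarrow> bool" where
  "projective_resolution R M n P d e \<longleftrightarrow>
     (\<forall>i. projective_module R (P i)) \<and>
     (\<forall>i>n. carrier (P i) = {\<zero>\<^bsub>P i\<^esub>}) \<and>
     e \<in> module_hom R (P 0) M \<and>
     (\<forall>i. d i \<in> module_hom R (P (Suc i)) (P i)) \<and>
     e ` carrier (P 0) = carrier M \<and>
     a_kernel (P 0) M e = d 0 ` carrier (P 1) \<and>
     (\<forall>i. a_kernel (P (Suc i)) (P i) (d i) = d (Suc i) ` carrier (P (Suc (Suc i))))"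

text \<open>
  A definition in HOL cannot quantify over types, so the type \<open>'u\<close> that holds the elements of the modules of
  a resolution is a parameter.  The value does not depend on \<open>'u\<close> as soon as \<open>'u\<close> is infinite and at least as
  large as \<open>R\<close> and \<open>M\<close> (Schanuel's lemma), and smaller types can only increase it.  A lower bound
  for all \<open>'u\<close> is thus a lower bound on the length of all projective resolutions of \<open>M\<close>.
\<close>

definition proj_dim ::
    "'u itself \<Rightarrow> ('r, 'x) ring_scheme \<Rightarrow> ('r, 'm, 'y) module_scheme \<Rightarrow> enat" where
  "proj_dim _ R M =
     Inf {enat n |n. \<exists>(P :: nat \<Rightarrow> ('r, 'u) module) d e. projective_resolution R M n P d e}"

text \<open>The submodule \<open>(f\<^sub>1, \<dots>, f\<^sub>n) M\<close> of \<open>M\<close>.\<close>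

definition list_mult_module :: "('r, 'm, 'y) module_scheme \<Rightarrow> 'r list \<Rightarrow> 'm set" where
  "list_mult_module M fs =
     {finsum M (\<lambda>j. fs ! j \<odot>\<^bsub>M\<^esub> m j) {..<length fs} |m. m \<in> {..<length fs} \<rightarrow> carrier M}"

text \<open>
  The second condition says that \<open>f\<^sub>j\<close> is a non-zero-divisor on \<open>M / (f\<^sub>1, \<dots>, f\<^bsub>j-1\<^esub>) M\<close>.
\<close>

definition regular_sequence ::
    "('r, 'x) ring_scheme \<Rightarrow> ('r, 'm, 'y) module_scheme \<Rightarrow> 'r list \<Rightarrow> bool" where
  "regular_sequence R M fs \<longleftrightarrow>
     set fs \<subseteq> carrier R \<and>
     (\<forall>j<length fs. \<forall>x\<in>carrier M.
        fs ! j \<odot>\<^bsub>M\<^esub> x \<in> list_mult_module M (take j fs) \<longrightarrow> x \<in> list_mult_module M (take j fs)) \<and>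
     list_mult_module M fs \<noteq> carrier M"

definition depth ::
    "('r, 'x) ring_scheme \<Rightarrow> 'r set \<Rightarrow> ('r, 'm, 'y) module_scheme \<Rightarrow> enat" where
  "depth R J M = Sup {enat (length fs) |fs. regular_sequence R M fs \<and> set fs \<subseteq> J}"

text \<open>
  Modules over \<open>mpoly_ring V\<close> have their depth taken with respect to the homogeneous maximal ideal.
\<close>

definition mpoly_max_ideal :: "'v set \<Rightarrow> ('v, 'k::field) mpoly set" where
  "mpoly_max_ideal V = genideal (mpoly_ring V) (var ` V)"

end

theory Submission
  imports Defs
begin

text \<open>
  Two vertices of the strong ladder lie in a common closed neighborhood exactly if their columns
  differ by at most 2.  For \<open>\<k> = \<two>\<close> the neighborhood ideal \<open>I\<close> is therefore the edge ideal of the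
  square of the ladder.  One vertex from each of the columns \<open>1, 4, 7, \<dots>\<close> gives a set \<open>A\<close> of
  \<open>c = \<lceil>r / 3\<rceil>\<close> vertices that is independent in the square, and every other vertex is joined to one
  of them there.  So the monomial \<open>w = \<Prod>A\<close> is not in \<open>I\<close>, while \<open>v w \<in> I\<close> for each of the \<open>2 r - c\<close>
  variables \<open>v\<close> outside \<open>A\<close>: the class of \<open>w\<close> generates a copy of \<open>K[A]\<close> in \<open>S / I\<close>, and both
  inequalities come from the associated prime that the variables outside \<open>A\<close> generate.

  For the projective dimension, let \<open>\<theta>\<close> be the sequence of the variables outside \<open>A\<close>.  It is regular
  on \<open>S\<close>, hence on every projective module, and it annihilates a nonzero element of \<open>S / I\<close>.  This
  makes \<open>Tor\<^sub>h (S / I, S / (\<theta>))\<close> nonzero for \<open>h = 2 r - c\<close>, so that no projective resolution can be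
  shorter than \<open>h\<close> (\<open>projective_resolution_length_ge\<close>).  The proof rephrases this argument in terms
  of elements of the modules of the resolution.

  For the depth, consider the Koszul complex of all variables with coefficients in \<open>S / I\<close>.  If \<open>f\<close>
  is in the maximal ideal and is a non-zero-divisor on a quotient \<open>S / J\<close>, then \<open>f\<close> annihilates the
  Koszul homology of \<open>S / J\<close>, and the connecting map embeds the homology of \<open>S / J\<close> in degree \<open>i\<close>
  into that of \<open>S / (J + (f))\<close> in degree \<open>i + 1\<close> (\<open>nonzero_homology_regular_element\<close>).  A regular
  sequence of length \<open>d\<close> thus lifts a nonzero class from degree \<open>i\<close> to degree \<open>i + d\<close>, and \<open>i + d\<close>
  is at most the number \<open>2 r\<close> of variables.  It remains to see that the homology of \<open>S / I\<close> is
  nonzero in degree \<open>2 r - c\<close>.  The class is \<open>w\<close> times the exterior product of the variables outside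
  \<open>A\<close>.  The two vertices of a column are twins, and exchanging them in any of the \<open>c\<close> columns of \<open>A\<close>
  gives \<open>2\<^sup>c\<close> independent sets, the facets of a cross-polytope.  Summing one coefficient of a chain
  for each of these sets defines a linear form which vanishes on boundaries and is 1 on the class
  (\<open>nonzero_homology_ladder_ideal\<close>).
\<close>

section \<open>Submodules generated by multiples of a sequence\<close>

lemma (in module) list_mult_module_Nil: "list_mult_module M [] = {\<zero>\<^bsub>M\<^esub>}"
  by (auto simp: list_mult_module_def)

lemma (in module) list_mult_module_snoc:
  assumes "set fs \<subseteq> carrier R" "f \<in> carrier R"
  shows "list_mult_module M (fs @ [f]) =
    {x \<oplus>\<^bsub>M\<^esub> f \<odot>\<^bsub>M\<^esub> y |x y. x \<in> list_mult_module M fs \<and> y \<in> carrier M}"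
proof -
  let ?n = "length fs"
  have nth: "fs ! j \<in> carrier R" if "j < ?n" for j
    using assms(1) that by (meson nth_mem subsetD)
  have split: "finsum M (\<lambda>j. (fs @ [f]) ! j \<odot>\<^bsub>M\<^esub> m j) {..<length (fs @ [f])} =
      finsum M (\<lambda>j. fs ! j \<odot>\<^bsub>M\<^esub> m j) {..<?n} \<oplus>\<^bsub>M\<^esub> f \<odot>\<^bsub>M\<^esub> m ?n"
    if m: "m \<in> {..?n} \<rightarrow> carrier M" for m
  proof -
    have "finsum M (\<lambda>j. (fs @ [f]) ! j \<odot>\<^bsub>M\<^esub> m j) {..<length (fs @ [f])} =
        f \<odot>\<^bsub>M\<^esub> m ?n \<oplus>\<^bsub>M\<^esub> finsum M (\<lambda>j. (fs @ [f]) ! j \<odot>\<^bsub>M\<^esub> m j) {..<?n}"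
      using m nth assms(2) by (simp add: lessThan_Suc, subst M.finsum_insert)
        (auto simp: nth_append Pi_iff)
    also have "finsum M (\<lambda>j. (fs @ [f]) ! j \<odot>\<^bsub>M\<^esub> m j) {..<?n} =
        finsum M (\<lambda>j. fs ! j \<odot>\<^bsub>M\<^esub> m j) {..<?n}"
      using m nth by (intro M.finsum_cong') (auto simp: nth_append Pi_iff)
    finally show ?thesis
      using m nth assms(2) by (subst M.a_comm) (auto simp: Pi_iff intro!: M.finsum_closed)
  qed
  show ?thesis
  proof (intro equalityI subsetI)
    fix z assume "z \<in> list_mult_module M (fs @ [f])"
    then obtain m where m: "m \<in> {..?n} \<rightarrow> carrier M"
      and z: "z = finsum M (\<lambda>j. (fs @ [f]) ! j \<odot>\<^bsub>M\<^esub> m j) {..<length (fs @ [f])}"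
      by (auto simp: list_mult_module_def lessThan_Suc_atMost)
    show "z \<in> {x \<oplus>\<^bsub>M\<^esub> f \<odot>\<^bsub>M\<^esub> y |x y. x \<in> list_mult_module M fs \<and> y \<in> carrier M}"
      unfolding z split[OF m] using m by (force simp: list_mult_module_def)
  next
    fix z assume "z \<in> {x \<oplus>\<^bsub>M\<^esub> f \<odot>\<^bsub>M\<^esub> y |x y. x \<in> list_mult_module M fs \<and> y \<in> carrier M}"
    then obtain m y where m: "m \<in> {..<?n} \<rightarrow> carrier M" and y: "y \<in> carrier M"
      and z: "z = finsum M (\<lambda>j. fs ! j \<odot>\<^bsub>M\<^esub> m j) {..<?n} \<oplus>\<^bsub>M\<^esub> f \<odot>\<^bsub>M\<^esub> y"
      by (auto simp: list_mult_module_def)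
    let ?m = "m(?n := y)"
    have m': "?m \<in> {..?n} \<rightarrow> carrier M" using m y by (auto simp: Pi_iff)
    have "finsum M (\<lambda>j. fs ! j \<odot>\<^bsub>M\<^esub> ?m j) {..<?n} = finsum M (\<lambda>j. fs ! j \<odot>\<^bsub>M\<^esub> m j) {..<?n}"
      using m nth by (intro M.finsum_cong') (auto simp: Pi_iff)
    then have "z = finsum M (\<lambda>j. (fs @ [f]) ! j \<odot>\<^bsub>M\<^esub> ?m j) {..<length (fs @ [f])}"
      unfolding split[OF m'] z by simp
    then show "z \<in> list_mult_module M (fs @ [f])"
      unfolding list_mult_module_def using m' by (intro CollectI exI[of _ ?m]) (simp add: lessThan_Suc_atMost)
  qed
qed

lemma (in module) list_mult_module_take_Suc:
  assumes "set fs \<subseteq> carrier R" "k < length fs"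
  shows "list_mult_module M (take (Suc k) fs) =
    {x \<oplus>\<^bsub>M\<^esub> fs ! k \<odot>\<^bsub>M\<^esub> y |x y. x \<in> list_mult_module M (take k fs) \<and> y \<in> carrier M}"
  using list_mult_module_snoc[of "take k fs" "fs ! k"] assms set_take_subset[of k fs]
  by (simp add: take_Suc_conv_app_nth subset_iff)

lemma (in module) list_mult_module_closed:
  assumes "set fs \<subseteq> carrier R"
  shows "x \<in> list_mult_module M fs \<Longrightarrow> x \<in> carrier M"
  using assms by (force simp: list_mult_module_def Pi_iff subset_iff intro!: M.finsum_closed)

lemma (in module) zero_in_list_mult_module:
  assumes "set fs \<subseteq> carrier R"
  shows "\<zero>\<^bsub>M\<^esub> \<in> list_mult_module M fs"
  using assms
proof (induction fs rule: rev_induct)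
  case (snoc f fs)
  then show ?case
    by (simp add: list_mult_module_snoc) (metis M.r_zero M.zero_closed smult_r_null)
qed (simp add: list_mult_module_Nil)

lemma (in module) list_mult_module_add:
  assumes "set fs \<subseteq> carrier R" "x \<in> list_mult_module M fs" "y \<in> list_mult_module M fs"
  shows "x \<oplus>\<^bsub>M\<^esub> y \<in> list_mult_module M fs"
  using assms
proof (induction fs arbitrary: x y rule: rev_induct)
  case (snoc f fs)
  then have fs: "set fs \<subseteq> carrier R" "f \<in> carrier R" by auto
  obtain x1 x2 y1 y2 where 1: "x = x1 \<oplus>\<^bsub>M\<^esub> f \<odot>\<^bsub>M\<^esub> x2" "y = y1 \<oplus>\<^bsub>M\<^esub> f \<odot>\<^bsub>M\<^esub> y2"
    and 2: "x1 \<in> list_mult_module M fs" "y1 \<in> list_mult_module M fs" "x2 \<in> carrier M" "y2 \<in> carrier M"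
    using snoc.prems by (auto simp: list_mult_module_snoc[OF fs])
  have "x \<oplus>\<^bsub>M\<^esub> y = (x1 \<oplus>\<^bsub>M\<^esub> y1) \<oplus>\<^bsub>M\<^esub> f \<odot>\<^bsub>M\<^esub> (x2 \<oplus>\<^bsub>M\<^esub> y2)"
    using 1 2 fs list_mult_module_closed[OF fs(1)] by (simp add: smult_r_distr M.a_ac)
  then show ?case
    using 2 snoc.IH[OF fs(1) 2(1,2)] by (auto simp: list_mult_module_snoc[OF fs])
qed (simp add: list_mult_module_Nil)

lemma (in module) list_mult_module_smult:
  assumes "set fs \<subseteq> carrier R" "a \<in> carrier R" "x \<in> list_mult_module M fs"
  shows "a \<odot>\<^bsub>M\<^esub> x \<in> list_mult_module M fs"
  using assms
proof (induction fs arbitrary: x rule: rev_induct)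
  case (snoc f fs)
  then have fs: "set fs \<subseteq> carrier R" "f \<in> carrier R" by auto
  obtain x1 x2 where 1: "x = x1 \<oplus>\<^bsub>M\<^esub> f \<odot>\<^bsub>M\<^esub> x2"
    and 2: "x1 \<in> list_mult_module M fs" "x2 \<in> carrier M"
    using snoc.prems by (auto simp: list_mult_module_snoc[OF fs])
  have "a \<odot>\<^bsub>M\<^esub> x = a \<odot>\<^bsub>M\<^esub> x1 \<oplus>\<^bsub>M\<^esub> f \<odot>\<^bsub>M\<^esub> (a \<odot>\<^bsub>M\<^esub> x2)"
    using 1 2 fs assms(2) list_mult_module_closed[OF fs(1)]
    by (simp add: smult_r_distr R.m_comm flip: smult_assoc1)
  then show ?case
    using 2 assms(2) snoc.IH[OF fs(1) assms(2) 2(1)] by (auto simp: list_mult_module_snoc[OF fs])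
qed (simp add: list_mult_module_Nil)

lemma (in module) list_mult_module_minus:
  assumes "set fs \<subseteq> carrier R" "x \<in> list_mult_module M fs" "y \<in> list_mult_module M fs"
  shows "x \<ominus>\<^bsub>M\<^esub> y \<in> list_mult_module M fs"
proof -
  have "\<ominus>\<^bsub>M\<^esub> y = (\<ominus>\<^bsub>R\<^esub> \<one>\<^bsub>R\<^esub>) \<odot>\<^bsub>M\<^esub> y"
    using smult_l_minus[of \<one> y] list_mult_module_closed[OF assms(1,3)] by simp
  then show ?thesis
    using assms by (simp add: M.minus_eq list_mult_module_add list_mult_module_smult)
qed

lemma list_mult_module_hom:
  assumes M: "module R M" and N: "module R N" and h: "h \<in> module_hom R M N"
    and "set fs \<subseteq> carrier R" "x \<in> list_mult_module M fs"
  shows "h x \<in> list_mult_module N fs"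
proof -
  interpret M: module R M by fact
  interpret N: module R N by fact
  have add: "h (x \<oplus>\<^bsub>M\<^esub> y) = h x \<oplus>\<^bsub>N\<^esub> h y" if "x \<in> carrier M" "y \<in> carrier M" for x y
    using h that by (auto simp: module_hom_def)
  have smult: "h (a \<odot>\<^bsub>M\<^esub> x) = a \<odot>\<^bsub>N\<^esub> h x" if "a \<in> carrier R" "x \<in> carrier M" for a x
    using h that by (auto simp: module_hom_def)
  have closed: "h x \<in> carrier N" if "x \<in> carrier M" for x
    using h that by (auto simp: module_hom_def)
  show ?thesis
    using assms(4,5)
  proof (induction fs arbitrary: x rule: rev_induct)
    case Nil
    have "h \<zero>\<^bsub>M\<^esub> = \<zero>\<^bsub>N\<^esub>"
      using smult[of "\<zero>\<^bsub>R\<^esub>" "\<zero>\<^bsub>M\<^esub>"] closed by simp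
    then show ?case using Nil by (simp add: M.list_mult_module_Nil N.list_mult_module_Nil)
  next
    case (snoc f fs)
    then have fs: "set fs \<subseteq> carrier R" "f \<in> carrier R" by auto
    obtain x1 x2 where 1: "x = x1 \<oplus>\<^bsub>M\<^esub> f \<odot>\<^bsub>M\<^esub> x2"
      and 2: "x1 \<in> list_mult_module M fs" "x2 \<in> carrier M"
      using snoc.prems by (auto simp: M.list_mult_module_snoc[OF fs])
    have "h x = h x1 \<oplus>\<^bsub>N\<^esub> f \<odot>\<^bsub>N\<^esub> h x2"
      using 1 2 fs M.list_mult_module_closed[OF fs(1)] by (simp add: add smult)
    then show ?case
      using snoc.IH[OF fs(1) 2(1)] 2 closed by (auto simp: N.list_mult_module_snoc[OF fs])
  qed
qed

section \<open>Regular sequences on projective modules\<close>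

text \<open>
  Only the condition on zero divisors of a regular sequence is kept.  A projective module may be
  zero, and then no sequence satisfies the condition that the quotient is nonzero.
\<close>

definition weakly_regular ::
    "('r, 'x) ring_scheme \<Rightarrow> ('r, 'm, 'y) module_scheme \<Rightarrow> 'r list \<Rightarrow> bool" where
  "weakly_regular R M fs \<longleftrightarrow>
     (\<forall>j<length fs. \<forall>x\<in>carrier M.
        fs ! j \<odot>\<^bsub>M\<^esub> x \<in> list_mult_module M (take j fs) \<longrightarrow> x \<in> list_mult_module M (take j fs))"

definition self_module :: "('r, 'x) ring_scheme \<Rightarrow> ('r, 'r) module" where
  "self_module R = \<lparr>carrier = carrier R, mult = mult R, one = one R, zero = zero R, add = add R,
     smult = mult R\<rparr>"

lemma (in cring) module_self_module: "module R (self_module R)"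
proof (rule moduleI)
  show "abelian_group (self_module R)"
    by (rule abelian_groupI)
      (auto simp: self_module_def a_ac intro: bexI[of _ "\<ominus> x" for x] l_neg)
qed (auto simp: self_module_def is_cring m_assoc l_distr r_distr)

lemma (in cring) module_free_module: "module R (free_module R B)"
proof (rule moduleI)
  have fin: "finite {b. h b \<noteq> \<zero>}" if "finite {b. f b \<noteq> \<zero>}" "finite {b. g b \<noteq> \<zero>}"
    "\<And>b. f b = \<zero> \<Longrightarrow> g b = \<zero> \<Longrightarrow> h b = \<zero>" for f g h :: "'c \<Rightarrow> 'a"
    by (rule finite_subset[of _ "{b. f b \<noteq> \<zero>} \<union> {b. g b \<noteq> \<zero>}"]) (use that in auto)
  show "abelian_group (free_module R B)"
  proof (rule abelian_groupI)
    fix f g assume "f \<in> carrier (free_module R B)" "g \<in> carrier (free_module R B)"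
    then show "f \<oplus>\<^bsub>free_module R B\<^esub> g \<in> carrier (free_module R B)"
      by (auto simp: free_module_def intro: fin[of f g]) (metis (mono_tags) l_zero mem_Collect_eq subsetD zero_closed)
  next
    fix f assume f: "f \<in> carrier (free_module R B)"
    show "\<exists>g\<in>carrier (free_module R B). g \<oplus>\<^bsub>free_module R B\<^esub> f = \<zero>\<^bsub>free_module R B\<^esub>"
      by (rule bexI[of _ "\<lambda>b. \<ominus> f b"])
        (use f in \<open>auto simp: free_module_def l_neg intro: fin[of f f]\<close>)
  qed (auto simp: free_module_def a_ac)
  show "a \<odot>\<^bsub>free_module R B\<^esub> f \<in> carrier (free_module R B)"
    if "a \<in> carrier R" "f \<in> carrier (free_module R B)" for a f
    using that by (auto simp: free_module_def intro: fin[of f f])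
qed (auto simp: free_module_def is_cring m_assoc l_distr r_distr)

text \<open>
  The coordinates are decomposed one by one.  Where a coordinate of \<open>f\<close> is zero its decomposition is
  chosen to be zero as well, which keeps the resulting families finitely supported.
\<close>

lemma (in cring) list_mult_module_free_module:
  assumes "set fs \<subseteq> carrier R" "f \<in> carrier (free_module R B)"
    "\<And>b. f b \<in> list_mult_module (self_module R) fs"
  shows "f \<in> list_mult_module (free_module R B) fs"
proof -
  interpret F: module R "free_module R B" by (rule module_free_module)
  interpret S: module R "self_module R" by (rule module_self_module)
  show ?thesis
    using assms
  proof (induction fs arbitrary: f rule: rev_induct)
    case Nil
    then have "f b = \<zero>" for b
      using Nil(3)[of b] unfolding S.list_mult_module_Nil by (simp add: self_module_def)
    then show ?case unfolding F.list_mult_module_Nil by (auto simp: free_module_def)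
  next
    case (snoc g fs)
    then have fs: "set fs \<subseteq> carrier R" "g \<in> carrier R" by auto
    let ?D = "\<lambda>b x y. x \<in> list_mult_module (self_module R) fs \<and> y \<in> carrier R \<and> f b = x \<oplus> g \<otimes> y"
    have "\<exists>x y. ?D b x y \<and> (f b = \<zero> \<longrightarrow> x = \<zero> \<and> y = \<zero>)" for b
    proof (cases "f b = \<zero>")
      case True
      then show ?thesis
        using fs S.zero_in_list_mult_module[OF fs(1)] by (auto simp: self_module_def)
    next
      case False
      then show ?thesis
        using snoc.prems(3)[of b] by (auto simp: S.list_mult_module_snoc[OF fs], auto simp: self_module_def)
    qed
    then obtain x y where xy: "\<And>b. ?D b (x b) (y b)" "\<And>b. f b = \<zero> \<Longrightarrow> x b = \<zero> \<and> y b = \<zero>"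
      by metis
    have xR: "x b \<in> carrier R" for b
      using S.list_mult_module_closed[OF fs(1)] xy(1)[of b] by (auto simp: self_module_def)
    have sub: "{b. x b \<noteq> \<zero>} \<subseteq> {b. f b \<noteq> \<zero>}" "{b. y b \<noteq> \<zero>} \<subseteq> {b. f b \<noteq> \<zero>}"
      using xy(2) by auto
    have x: "x \<in> carrier (free_module R B)" and y: "y \<in> carrier (free_module R B)"
      using snoc.prems(2) xR xy(1) sub by (auto simp: free_module_def intro: finite_subset)
    have "f = x \<oplus>\<^bsub>free_module R B\<^esub> g \<odot>\<^bsub>free_module R B\<^esub> y"
      using xy(1) by (auto simp: free_module_def)
    moreover have "x \<in> list_mult_module (free_module R B) fs"
      using snoc.IH[OF fs(1) x] xy(1) by blast
    ultimately show ?case using y by (auto simp: F.list_mult_module_snoc[OF fs])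
  qed
qed

lemma (in cring) weakly_regular_free_module:
  assumes "set fs \<subseteq> carrier R" "weakly_regular R (self_module R) fs"
  shows "weakly_regular R (free_module R B) fs"
  unfolding weakly_regular_def
proof (intro allI impI ballI)
  fix j x assume j: "j < length fs" and x: "x \<in> carrier (free_module R B)"
    and *: "fs ! j \<odot>\<^bsub>free_module R B\<^esub> x \<in> list_mult_module (free_module R B) (take j fs)"
  have fsj: "set (take j fs) \<subseteq> carrier R" using assms(1) set_take_subset by fastforce
  have coord: "(\<lambda>f. f b) \<in> module_hom R (free_module R B) (self_module R)" for b
    by (auto simp: module_hom_def free_module_def self_module_def)
  have "x b \<in> list_mult_module (self_module R) (take j fs)" for b
  proof -
    have "fs ! j \<odot>\<^bsub>self_module R\<^esub> x b \<in> list_mult_module (self_module R) (take j fs)"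
      using list_mult_module_hom[OF module_free_module module_self_module coord[of b] fsj *]
      by (simp add: free_module_def self_module_def)
    moreover have "x b \<in> carrier (self_module R)" using x by (auto simp: free_module_def self_module_def)
    ultimately show ?thesis using assms(2) j by (auto simp: weakly_regular_def)
  qed
  then show "x \<in> list_mult_module (free_module R B) (take j fs)"
    using list_mult_module_free_module[OF fsj x] by blast
qed

text \<open>
  Coordinatewise the sequence is regular on a free module, and a projective module is a retract of
  one: map into the free module, divide there, and map back.
\<close>

lemma weakly_regular_projective_module:
  fixes P :: "('r, 'u, 'y) module_scheme"
  assumes "cring R" "set fs \<subseteq> carrier R" "weakly_regular R (self_module R) fs"
    and P: "projective_module R P"
  shows "weakly_regular R P fs"
proof -
  interpret cring R by fact
  from P obtain B :: "'u set" and i p where i: "i \<in> module_hom R P (free_module R B)"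
    and p: "p \<in> module_hom R (free_module R B) P" and pi: "\<And>x. x \<in> carrier P \<Longrightarrow> p (i x) = x"
    and "module R P"
    unfolding projective_module_def by blast
  then interpret P: module R P by simp
  show ?thesis
    unfolding weakly_regular_def
  proof (intro allI impI ballI)
    fix j x assume j: "j < length fs" and x: "x \<in> carrier P"
      and *: "fs ! j \<odot>\<^bsub>P\<^esub> x \<in> list_mult_module P (take j fs)"
    have fsj: "set (take j fs) \<subseteq> carrier R" "fs ! j \<in> carrier R"
      using assms(2) set_take_subset[of j fs] j by auto
    have "i (fs ! j \<odot>\<^bsub>P\<^esub> x) \<in> list_mult_module (free_module R B) (take j fs)"
      by (rule list_mult_module_hom[OF P.module_axioms module_free_module i fsj(1) *])
    moreover have "i (fs ! j \<odot>\<^bsub>P\<^esub> x) = fs ! j \<odot>\<^bsub>free_module R B\<^esub> i x" "i x \<in> carrier (free_module R B)"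
      using i x fsj by (auto simp: module_hom_def)
    ultimately have "i x \<in> list_mult_module (free_module R B) (take j fs)"
      using weakly_regular_free_module[OF assms(2,3), of B] j by (auto simp: weakly_regular_def)
    then have "p (i x) \<in> list_mult_module P (take j fs)"
      by (rule list_mult_module_hom[OF module_free_module P.module_axioms p fsj(1)])
    then show "x \<in> list_mult_module P (take j fs)" using pi x by simp
  qed
qed

section \<open>The length of projective resolutions\<close>

lemma (in abelian_group) add_add_minus_cancel:
  assumes "x \<in> carrier G" "y \<in> carrier G"
  shows "x \<oplus> (y \<oplus> \<ominus> x) = y"
  using assms by (subst a_lcomm) (simp_all add: r_neg)

lemma (in abelian_group) minus_minus_cancel:
  assumes "x \<in> carrier G" "a \<in> carrier G" "u \<in> carrier G"
  shows "(x \<ominus> u) \<ominus> (x \<ominus> a) = a \<ominus> u"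
  using assms by (simp add: minus_eq minus_add a_ac add_add_minus_cancel)

lemma (in abelian_group) add_minus_cancel:
  assumes "w \<in> carrier G" "y \<in> carrier G"
  shows "(w \<oplus> y) \<ominus> w = y"
  using assms by (simp add: minus_eq a_ac add_add_minus_cancel)

lemma (in abelian_group) minus_add_cancel:
  assumes "x \<in> carrier G" "y \<in> carrier G"
  shows "(x \<ominus> y) \<oplus> y = x"
  using assms by (simp add: minus_eq a_assoc l_neg)

lemma (in abelian_group) minus_add_add_cancel:
  assumes "x \<in> carrier G" "y \<in> carrier G" "b \<in> carrier G"
  shows "(x \<ominus> (y \<oplus> b)) \<oplus> y = x \<ominus> b"
  using assms by (simp add: minus_eq minus_add a_ac add_add_minus_cancel)

lemma (in module) smult_minus:
  assumes "a \<in> carrier R" "x \<in> carrier M" "y \<in> carrier M"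
  shows "a \<odot>\<^bsub>M\<^esub> (x \<ominus>\<^bsub>M\<^esub> y) = a \<odot>\<^bsub>M\<^esub> x \<ominus>\<^bsub>M\<^esub> a \<odot>\<^bsub>M\<^esub> y"
  using assms by (simp add: M.minus_eq smult_r_distr smult_r_minus)

lemma module_homD:
  assumes "h \<in> module_hom R M N"
  shows "x \<in> carrier M \<Longrightarrow> h x \<in> carrier N"
    and "x \<in> carrier M \<Longrightarrow> y \<in> carrier M \<Longrightarrow> h (x \<oplus>\<^bsub>M\<^esub> y) = h x \<oplus>\<^bsub>N\<^esub> h y"
    and "a \<in> carrier R \<Longrightarrow> x \<in> carrier M \<Longrightarrow> h (a \<odot>\<^bsub>M\<^esub> x) = a \<odot>\<^bsub>N\<^esub> h x"
  using assms by (auto simp: module_hom_def)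

lemma module_hom_minus:
  assumes "module R M" "module R N" "h \<in> module_hom R M N" "x \<in> carrier M" "y \<in> carrier M"
  shows "h (x \<ominus>\<^bsub>M\<^esub> y) = h x \<ominus>\<^bsub>N\<^esub> h y"
proof -
  interpret M: module R M by fact
  interpret N: module R N by fact
  note h = module_homD[OF assms(3)]
  have "h (x \<ominus>\<^bsub>M\<^esub> y) \<oplus>\<^bsub>N\<^esub> h y = h x"
    using assms(4,5) by (simp add: M.minus_eq M.a_assoc M.l_neg flip: h(2))
  then show ?thesis
    using h(1) assms(4,5) by (metis M.minus_closed N.add.inv_solve_right' N.minus_eq)
qed

text \<open>
  Write \<open>(\<theta>)\<^sub>k\<close> for the ideal of the first \<open>k\<close> entries of \<open>\<theta>\<close> and \<open>Tor\<^sub>i (k)\<close> for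
  \<open>Tor\<^sub>i (M, R / (\<theta>)\<^sub>k)\<close>, which the complex \<open>P / (\<theta>)\<^sub>k P\<close> computes.  As \<open>\<theta>\<close> is regular on each
  \<open>P i\<close>, multiplication by the next entry \<open>z\<close> is injective on this complex and has the complex for
  \<open>k + 1\<close> as its cokernel.  The long exact sequence gives two facts by induction on \<open>k\<close>:
  \<open>Tor\<^sub>i (k) = 0\<close> for \<open>i > k\<close>, and \<open>Tor\<^sub>k\<^sub>+\<^sub>1 (k + 1)\<close> is the part of \<open>Tor\<^sub>k (k)\<close> that \<open>z\<close>
  annihilates.  A nonzero element of \<open>M = Tor\<^sub>0 (0)\<close> that all of \<open>\<theta>\<close> annihilates therefore yields a
  nonzero element of \<open>Tor\<^sub>h (h)\<close> for the length \<open>h\<close> of \<open>\<theta>\<close>, and so \<open>P h\<close> is not zero.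
\<close>

lemma projective_resolution_length_ge:
  fixes P :: "nat \<Rightarrow> ('r, 'u) module"
  assumes R: "cring R" and res: "projective_resolution R M n P d e"
    and th: "set \<theta> \<subseteq> carrier R" and reg: "weakly_regular R (self_module R) \<theta>"
    and m: "m \<in> carrier M" "m \<noteq> \<zero>\<^bsub>M\<^esub>" "\<And>j. j < length \<theta> \<Longrightarrow> \<theta> ! j \<odot>\<^bsub>M\<^esub> m = \<zero>\<^bsub>M\<^esub>"
  shows "length \<theta> \<le> n"
proof (rule ccontr)
  assume "\<not> length \<theta> \<le> n"
  then have n: "n < length \<theta>" by simp
  interpret R: cring R by fact
  have proj: "projective_module R (P i)" for i
    using res by (simp add: projective_resolution_def)
  then have mod: "module R (P i)" for i by (simp add: projective_module_def)
  interpret P: module R "P i" for i by (rule mod)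
  have d: "d i \<in> module_hom R (P (Suc i)) (P i)" for i
    using res by (simp add: projective_resolution_def)
  note dD = module_homD[OF d] and dm = module_hom_minus[OF mod mod d]
  have ex: "{x \<in> carrier (P (Suc i)). d i x = \<zero>\<^bsub>P i\<^esub>} = d (Suc i) ` carrier (P (Suc (Suc i)))" for i
    using res by (simp add: projective_resolution_def a_kernel_def')
  have d0: "d i \<zero>\<^bsub>P (Suc i)\<^esub> = \<zero>\<^bsub>P i\<^esub>" for i
    using ex[of i] dD(3)[of "\<zero>\<^bsub>R\<^esub>" "\<zero>\<^bsub>P (Suc i)\<^esub>"] by (simp add: dD(1))
  define L where "L k i = list_mult_module (P i) (take k \<theta>)" for k i
  have thk: "set (take k \<theta>) \<subseteq> carrier R" for k
    using th set_take_subset[of k \<theta>] by blast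
  have thj: "\<theta> ! j \<in> carrier R" if "j < length \<theta>" for j using that th by auto
  note Lc = P.list_mult_module_closed[OF thk, folded L_def]
    and L0 = P.zero_in_list_mult_module[OF thk, folded L_def]
    and Ladd = P.list_mult_module_add[OF thk, folded L_def]
    and Lsm = P.list_mult_module_smult[OF thk, folded L_def]
    and Lmin = P.list_mult_module_minus[OF thk, folded L_def]
    and Lhom = list_mult_module_hom[OF mod mod d thk, folded L_def]
  have LSuc: "L (Suc k) i = {x \<oplus>\<^bsub>P i\<^esub> \<theta> ! k \<odot>\<^bsub>P i\<^esub> y |x y. x \<in> L k i \<and> y \<in> carrier (P i)}"
    if "k < length \<theta>" for k i
    unfolding L_def using P.list_mult_module_take_Suc[OF th that] .
  have Lreg: "x \<in> L k i"
    if "k < length \<theta>" "x \<in> carrier (P i)" "\<theta> ! k \<odot>\<^bsub>P i\<^esub> x \<in> L k i" for k i x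
    using weakly_regular_projective_module[OF R th reg proj[of i]] that
    by (auto simp: weakly_regular_def L_def)
  \<comment> \<open>\<open>Tor\<^sub>i\<^sub>+\<^sub>1 (k) = 0\<close> for \<open>i \<ge> k\<close>\<close>
  have E: "\<exists>q\<in>carrier (P (Suc (Suc i))). \<exists>y\<in>L k (Suc i). p = d (Suc i) q \<oplus>\<^bsub>P (Suc i)\<^esub> y"
    if "k \<le> length \<theta>" "k \<le> i" "p \<in> carrier (P (Suc i))" "d i p \<in> L k i" for k i p
    using that
  proof (induction k arbitrary: i p)
    case 0
    then obtain q where "q \<in> carrier (P (Suc (Suc i)))" "p = d (Suc i) q"
      using ex[of i] by (auto simp: L_def P.list_mult_module_Nil)
    then show ?case using L0[of "Suc i" 0] dD(1)
      by (intro bexI[of _ q] bexI[of _ "\<zero>\<^bsub>P (Suc i)\<^esub>"]) auto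
  next
    case (Suc k)
    let ?z = "\<theta> ! k"
    have k: "k < length \<theta>" and z: "?z \<in> carrier R" using Suc.prems(1) thj by auto
    obtain i' where i: "i = Suc i'" and i': "k \<le> i'" using Suc.prems(2) by (cases i) auto
    obtain y q where y: "y \<in> L k i" and q: "q \<in> carrier (P i)"
      and dp: "d i p = y \<oplus>\<^bsub>P i\<^esub> ?z \<odot>\<^bsub>P i\<^esub> q"
      using Suc.prems(4) by (auto simp: LSuc[OF k])
    have yc: "y \<in> carrier (P i)" by (rule Lc[OF y])
    have "d i' (d i p) = \<zero>\<^bsub>P i'\<^esub>"
      using ex[of i'] Suc.prems(3) unfolding i by auto
    then have "d i' y \<oplus>\<^bsub>P i'\<^esub> ?z \<odot>\<^bsub>P i'\<^esub> d i' q = \<zero>\<^bsub>P i'\<^esub>"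
      using yc q z unfolding dp unfolding i by (simp add: dD)
    moreover have dy: "d i' y \<in> carrier (P i')" and dq: "d i' q \<in> carrier (P i')"
      using yc q dD(1) unfolding i by auto
    ultimately have "\<ominus>\<^bsub>P i'\<^esub> d i' y = ?z \<odot>\<^bsub>P i'\<^esub> d i' q"
      using z by (intro P.minus_equality) (simp_all add: P.a_comm)
    then have "?z \<odot>\<^bsub>P i'\<^esub> d i' q = \<zero>\<^bsub>P i'\<^esub> \<ominus>\<^bsub>P i'\<^esub> d i' y"
      using dy dq z by (simp add: P.minus_eq)
    then have "?z \<odot>\<^bsub>P i'\<^esub> d i' q \<in> L k i'"
      using Lmin[OF L0 Lhom[OF y[unfolded i]]] by simp
    then have "d i' q \<in> L k i'" using Lreg[OF k] q dD(1) unfolding i by blast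
    then obtain s y' where s: "s \<in> carrier (P (Suc i))" and y': "y' \<in> L k i"
      and qs: "q = d i s \<oplus>\<^bsub>P i\<^esub> y'"
      using Suc.IH[of i' q] k i' q unfolding i by auto
    have y'c: "y' \<in> carrier (P i)" by (rule Lc[OF y'])
    \<comment> \<open>Since \<open>d i p\<close> is \<open>?z\<close> times the boundary of \<open>s\<close> up to the first \<open>k\<close> entries, subtracting
      \<open>?z\<close> times \<open>s\<close> makes \<open>p\<close> a cycle modulo these.\<close>
    define p' where "p' = p \<ominus>\<^bsub>P (Suc i)\<^esub> ?z \<odot>\<^bsub>P (Suc i)\<^esub> s"
    have p': "p' \<in> carrier (P (Suc i))" using Suc.prems(3) s z by (simp add: p'_def)
    have "d i p' = (y \<oplus>\<^bsub>P i\<^esub> ?z \<odot>\<^bsub>P i\<^esub> (d i s \<oplus>\<^bsub>P i\<^esub> y')) \<ominus>\<^bsub>P i\<^esub> ?z \<odot>\<^bsub>P i\<^esub> d i s"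
      using Suc.prems(3) s z by (simp add: p'_def dm dD dp flip: qs)
    also have "\<dots> = y \<oplus>\<^bsub>P i\<^esub> ?z \<odot>\<^bsub>P i\<^esub> y'"
      using yc y'c s z dD(1)[OF s]
      by (simp add: P.smult_r_distr P.a_lcomm[of y] P.add_minus_cancel)
    also have "\<dots> \<in> L k i" using y y' z by (intro Ladd Lsm)
    finally obtain t y'' where t: "t \<in> carrier (P (Suc (Suc i)))" and y'': "y'' \<in> L k (Suc i)"
      and p't: "p' = d (Suc i) t \<oplus>\<^bsub>P (Suc i)\<^esub> y''"
      using Suc.IH[of i p'] k p' Suc.prems(2) by auto
    have y''c: "y'' \<in> carrier (P (Suc i))" by (rule Lc[OF y''])
    have "p = p' \<oplus>\<^bsub>P (Suc i)\<^esub> ?z \<odot>\<^bsub>P (Suc i)\<^esub> s"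
      using Suc.prems(3) s z by (simp add: p'_def P.minus_add_cancel)
    also have "\<dots> = d (Suc i) t \<oplus>\<^bsub>P (Suc i)\<^esub> (y'' \<oplus>\<^bsub>P (Suc i)\<^esub> ?z \<odot>\<^bsub>P (Suc i)\<^esub> s)"
      using t y''c s z dD(1)[OF t] by (simp add: p't P.a_assoc)
    finally show ?case using t y'' s by (auto simp: LSuc[OF k])
  qed
  \<comment> \<open>\<open>p\<close> represents a nonzero element of \<open>Tor\<^sub>k (k)\<close> that all entries of \<open>\<theta>\<close> annihilate.\<close>
  have N: "\<exists>p\<in>carrier (P k). (\<forall>q\<in>carrier (P (Suc k)). p \<ominus>\<^bsub>P k\<^esub> d k q \<notin> L k k) \<and>
      (\<forall>j<length \<theta>. \<exists>q\<in>carrier (P (Suc k)). \<theta> ! j \<odot>\<^bsub>P k\<^esub> p \<ominus>\<^bsub>P k\<^esub> d k q \<in> L k k)"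
    if "k \<le> length \<theta>" for k
    using that
  proof (induction k)
    case 0
    have e: "e \<in> module_hom R (P 0) M" "e ` carrier (P 0) = carrier M"
      and ker: "{x \<in> carrier (P 0). e x = \<zero>\<^bsub>M\<^esub>} = d 0 ` carrier (P (Suc 0))"
      using res by (auto simp: projective_resolution_def a_kernel_def')
    obtain p where p: "p \<in> carrier (P 0)" and ep: "e p = m" using e(2) m(1) by (metis imageE)
    have "p \<ominus>\<^bsub>P 0\<^esub> d 0 q \<noteq> \<zero>\<^bsub>P 0\<^esub>" if q: "q \<in> carrier (P (Suc 0))" for q
    proof
      assume "p \<ominus>\<^bsub>P 0\<^esub> d 0 q = \<zero>\<^bsub>P 0\<^esub>"
      then have "p = d 0 q"
        using P.minus_add_cancel[OF p dD(1)[OF q]] dD(1)[OF q] by simp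
      then show False using ker q ep m(2) by auto
    qed
    moreover have "\<exists>q\<in>carrier (P (Suc 0)). \<theta> ! j \<odot>\<^bsub>P 0\<^esub> p \<ominus>\<^bsub>P 0\<^esub> d 0 q = \<zero>\<^bsub>P 0\<^esub>"
      if j: "j < length \<theta>" for j
    proof -
      have "\<theta> ! j \<odot>\<^bsub>P 0\<^esub> p \<in> d 0 ` carrier (P (Suc 0))"
        using p m(3)[OF j] ep module_homD(3)[OF e(1)] thj[OF j] by (auto simp flip: ker)
      then obtain q where q: "q \<in> carrier (P (Suc 0))" "\<theta> ! j \<odot>\<^bsub>P 0\<^esub> p = d 0 q" by blast
      then have "\<theta> ! j \<odot>\<^bsub>P 0\<^esub> p \<ominus>\<^bsub>P 0\<^esub> d 0 q = \<zero>\<^bsub>P 0\<^esub>"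
        using dD(1)[OF q(1)] by (simp add: P.minus_eq P.r_neg)
      then show ?thesis using q(1) by blast
    qed
    ultimately show ?case using p by (auto simp: L_def P.list_mult_module_Nil)
  next
    case (Suc k)
    let ?z = "\<theta> ! k"
    have k: "k < length \<theta>" and z: "?z \<in> carrier R" using Suc.prems thj by auto
    obtain p where p: "p \<in> carrier (P k)"
      and nb: "\<And>q. q \<in> carrier (P (Suc k)) \<Longrightarrow> p \<ominus>\<^bsub>P k\<^esub> d k q \<notin> L k k"
      and kill: "\<And>j. j < length \<theta> \<Longrightarrow>
        \<exists>q\<in>carrier (P (Suc k)). \<theta> ! j \<odot>\<^bsub>P k\<^esub> p \<ominus>\<^bsub>P k\<^esub> d k q \<in> L k k"
      using Suc.IH k by auto
    \<comment> \<open>A chain whose boundary witnesses that \<open>?z\<close> annihilates the class of \<open>p\<close> is the lift of this class under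
      the connecting map.\<close>
    obtain q where q: "q \<in> carrier (P (Suc k))" and pq: "?z \<odot>\<^bsub>P k\<^esub> p \<ominus>\<^bsub>P k\<^esub> d k q \<in> L k k"
      using kill[OF k] by blast
    note dq = dD(1)[OF q]
    show ?case
    proof (intro bexI[OF _ q] conjI ballI allI impI notI)
      fix s assume s: "s \<in> carrier (P (Suc (Suc k)))"
        and qs: "q \<ominus>\<^bsub>P (Suc k)\<^esub> d (Suc k) s \<in> L (Suc k) (Suc k)"
      then obtain y q' where y: "y \<in> L k (Suc k)" and q': "q' \<in> carrier (P (Suc k))"
        and eq: "q \<ominus>\<^bsub>P (Suc k)\<^esub> d (Suc k) s = y \<oplus>\<^bsub>P (Suc k)\<^esub> ?z \<odot>\<^bsub>P (Suc k)\<^esub> q'"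
        by (auto simp: LSuc[OF k])
      have "d k (d (Suc k) s) = \<zero>\<^bsub>P k\<^esub>" using ex[of k] s by auto
      then have "d k (q \<ominus>\<^bsub>P (Suc k)\<^esub> d (Suc k) s) = d k q"
        using dm[OF q dD(1)[OF s]] dq by (simp add: P.minus_eq)
      then have "d k q = d k y \<oplus>\<^bsub>P k\<^esub> ?z \<odot>\<^bsub>P k\<^esub> d k q'"
        using Lc[OF y] q' z unfolding eq by (simp add: dD)
      moreover have dy: "d k y \<in> L k k" by (rule Lhom[OF y])
      ultimately have "?z \<odot>\<^bsub>P k\<^esub> (p \<ominus>\<^bsub>P k\<^esub> d k q') =
          (?z \<odot>\<^bsub>P k\<^esub> p \<ominus>\<^bsub>P k\<^esub> d k q) \<oplus>\<^bsub>P k\<^esub> d k y"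
        using Lc[OF dy] p z dD(1)[OF q'] by (simp add: P.smult_minus P.minus_add_add_cancel)
      also have "\<dots> \<in> L k k" by (rule Ladd[OF pq dy])
      finally have "p \<ominus>\<^bsub>P k\<^esub> d k q' \<in> L k k" using Lreg[OF k] p q' dD(1) by simp
      then show False using nb[OF q'] by simp
    next
      fix j assume j: "j < length \<theta>"
      let ?t = "\<theta> ! j"
      have t: "?t \<in> carrier R" by (rule thj[OF j])
      obtain u where u: "u \<in> carrier (P (Suc k))" and pu: "?t \<odot>\<^bsub>P k\<^esub> p \<ominus>\<^bsub>P k\<^esub> d k u \<in> L k k"
        using kill[OF j] by blast
      note du = dD(1)[OF u]
      let ?v = "?t \<odot>\<^bsub>P (Suc k)\<^esub> q \<ominus>\<^bsub>P (Suc k)\<^esub> ?z \<odot>\<^bsub>P (Suc k)\<^esub> u"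
      have v: "?v \<in> carrier (P (Suc k))" using t z q u by simp
      have swap: "?z \<odot>\<^bsub>P k\<^esub> (?t \<odot>\<^bsub>P k\<^esub> p) = ?t \<odot>\<^bsub>P k\<^esub> (?z \<odot>\<^bsub>P k\<^esub> p)"
        using t z p by (simp add: R.m_comm flip: P.smult_assoc1)
      \<comment> \<open>\<open>d k q\<close> is \<open>?z\<close> times \<open>p\<close> and \<open>d k u\<close> is \<open>?t\<close> times \<open>p\<close> up to the first \<open>k\<close> entries, so \<open>?v\<close> is a
        cycle modulo these, and hence a boundary by the vanishing above.\<close>
      have "d k ?v = ?t \<odot>\<^bsub>P k\<^esub> d k q \<ominus>\<^bsub>P k\<^esub> ?z \<odot>\<^bsub>P k\<^esub> d k u"
        using t z q u by (simp add: dm dD)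
      also have "\<dots> = ?z \<odot>\<^bsub>P k\<^esub> (?t \<odot>\<^bsub>P k\<^esub> p \<ominus>\<^bsub>P k\<^esub> d k u) \<ominus>\<^bsub>P k\<^esub>
          ?t \<odot>\<^bsub>P k\<^esub> (?z \<odot>\<^bsub>P k\<^esub> p \<ominus>\<^bsub>P k\<^esub> d k q)"
        using t z p dq du by (simp add: P.smult_minus swap P.minus_minus_cancel)
      also have "\<dots> \<in> L k k" by (intro Lmin Lsm pu pq t z)
      finally obtain w y where w: "w \<in> carrier (P (Suc (Suc k)))" and y: "y \<in> L k (Suc k)"
        and vw: "?v = d (Suc k) w \<oplus>\<^bsub>P (Suc k)\<^esub> y"
        using E[OF less_imp_le[OF k] order_refl v] by blast
      have dw: "d (Suc k) w \<in> carrier (P (Suc k))" by (rule dD(1)[OF w])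
      have yc: "y \<in> carrier (P (Suc k))" by (rule Lc[OF y])
      have "?t \<odot>\<^bsub>P (Suc k)\<^esub> q = ?v \<oplus>\<^bsub>P (Suc k)\<^esub> ?z \<odot>\<^bsub>P (Suc k)\<^esub> u"
        using t z q u by (simp add: P.minus_add_cancel)
      then have "?t \<odot>\<^bsub>P (Suc k)\<^esub> q \<ominus>\<^bsub>P (Suc k)\<^esub> d (Suc k) w = y \<oplus>\<^bsub>P (Suc k)\<^esub> ?z \<odot>\<^bsub>P (Suc k)\<^esub> u"
        unfolding vw using dw yc z u by (simp add: P.a_assoc P.add_minus_cancel)
      then have "?t \<odot>\<^bsub>P (Suc k)\<^esub> q \<ominus>\<^bsub>P (Suc k)\<^esub> d (Suc k) w \<in> L (Suc k) (Suc k)"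
        using y u unfolding LSuc[OF k] by blast
      then show "\<exists>w\<in>carrier (P (Suc (Suc k))).
          ?t \<odot>\<^bsub>P (Suc k)\<^esub> q \<ominus>\<^bsub>P (Suc k)\<^esub> d (Suc k) w \<in> L (Suc k) (Suc k)"
        using w by blast
    qed
  qed
  obtain p where p: "p \<in> carrier (P (length \<theta>))"
    and nb: "\<And>q. q \<in> carrier (P (Suc (length \<theta>))) \<Longrightarrow>
      p \<ominus>\<^bsub>P (length \<theta>)\<^esub> d (length \<theta>) q \<notin> L (length \<theta>) (length \<theta>)"
    using N[OF order_refl] by blast
  have "carrier (P (length \<theta>)) = {\<zero>\<^bsub>P (length \<theta>)\<^esub>}"
    using res n unfolding projective_resolution_def by blast
  then have "p = \<zero>\<^bsub>P (length \<theta>)\<^esub>" using p by blast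
  then have "p \<ominus>\<^bsub>P (length \<theta>)\<^esub> d (length \<theta>) \<zero>\<^bsub>P (Suc (length \<theta>))\<^esub> = \<zero>\<^bsub>P (length \<theta>)\<^esub>"
    by (simp add: d0 P.minus_eq)
  then show False using nb[OF P.zero_closed] L0[of "length \<theta>" "length \<theta>"] by argo
qed

corollary proj_dim_ge_length_regular_annihilator:
  assumes "cring R" "set \<theta> \<subseteq> carrier R" "weakly_regular R (self_module R) \<theta>"
    and "m \<in> carrier M" "m \<noteq> \<zero>\<^bsub>M\<^esub>" "\<And>j. j < length \<theta> \<Longrightarrow> \<theta> ! j \<odot>\<^bsub>M\<^esub> m = \<zero>\<^bsub>M\<^esub>"
  shows "enat (length \<theta>) \<le> proj_dim TYPE('u) R M"
  unfolding proj_dim_def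
  using projective_resolution_length_ge[OF assms(1) _ assms(2-6)] by (auto intro!: Inf_greatest)

section \<open>Quotients of the ring\<close>

lemma quotient_module_simps:
  "carrier (quotient_module R I) = carrier (R Quot I)"
  "zero (quotient_module R I) = zero (R Quot I)"
  "add (quotient_module R I) = add (R Quot I)"
  "smult (quotient_module R I) = (\<lambda>a C. (I +>\<^bsub>R\<^esub> a) \<otimes>\<^bsub>R Quot I\<^esub> C)"
  by (simp_all add: quotient_module_def ring.defs)

lemma (in cring) module_quotient_module:
  assumes "ideal I R"
  shows "module R (quotient_module R I)"
proof -
  interpret I: ideal I R by fact
  interpret Q: cring "R Quot I" by (rule I.quotient_is_cring[OF is_cring])
  interpret h: ring_hom_ring R "R Quot I" "(+>) I" by (rule I.rcos_ring_hom_ring)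
  show ?thesis
  proof (rule moduleI)
    show "abelian_group (quotient_module R I)"
    proof (rule abelian_groupI)
      fix x assume "x \<in> carrier (quotient_module R I)"
      then show "\<exists>y\<in>carrier (quotient_module R I).
          y \<oplus>\<^bsub>quotient_module R I\<^esub> x = \<zero>\<^bsub>quotient_module R I\<^esub>"
        unfolding quotient_module_simps using Q.l_neg Q.a_inv_closed by blast
    qed (simp_all add: quotient_module_simps Q.a_assoc, simp add: Q.a_comm)
  qed (simp_all add: quotient_module_simps is_cring Q.m_assoc Q.l_distr Q.r_distr)
qed

lemma (in cring) rcos_module_hom:
  assumes "ideal I R"
  shows "(+>) I \<in> module_hom R (self_module R) (quotient_module R I)"
    and "(+>) I ` carrier R = carrier (quotient_module R I)"
    and "\<zero>\<^bsub>quotient_module R I\<^esub> = I"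
proof -
  interpret I: ideal I R by fact
  interpret h: ring_hom_ring R "R Quot I" "(+>) I" by (rule I.rcos_ring_hom_ring)
  show "(+>) I \<in> module_hom R (self_module R) (quotient_module R I)"
    unfolding module_hom_def quotient_module_simps self_module_def ring.simps Module.module.simps partial_object.simps monoid.simps
    by (intro CollectI conjI ballI funcsetI) (rule h.hom_closed h.hom_add h.hom_mult; assumption)+
  show "(+>) I ` carrier R = carrier (quotient_module R I)"
    unfolding quotient_module_simps FactRing_def partial_object.simps A_RCOSETS_def' by blast
  show "\<zero>\<^bsub>quotient_module R I\<^esub> = I"
    by (simp only: quotient_module_simps FactRing_def ring.simps)
qed

text \<open>
  Adjoining one more element to a sequence enlarges the preimage in \<open>R\<close> of the submodule of \<open>R / I\<close>
  that the sequence generates by the multiples of that element.  Statements on the quotients of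
  \<open>R / I\<close> become statements on ideals of \<open>R\<close> in this way.
\<close>

lemma (in cring) list_mult_quotient_take_Suc:
  assumes I: "ideal I R" and fs: "set fs \<subseteq> carrier R" "j < length fs" and p: "p \<in> carrier R"
  defines "M \<equiv> quotient_module R I"
  shows "I +> p \<in> list_mult_module M (take (Suc j) fs) \<longleftrightarrow>
    (\<exists>a\<in>carrier R. \<exists>b\<in>carrier R. p = a \<oplus> fs ! j \<otimes> b \<and> I +> a \<in> list_mult_module M (take j fs))"
proof -
  interpret M: module R M unfolding M_def by (rule module_quotient_module[OF I])
  note hom = rcos_module_hom(1)[OF I, folded M_def]
  have add: "I +> (a \<oplus> b) = (I +> a) \<oplus>\<^bsub>M\<^esub> (I +> b)" if "a \<in> carrier R" "b \<in> carrier R" for a b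
    using module_homD(2)[OF hom] that by (simp add: self_module_def)
  have smult: "I +> (a \<otimes> b) = a \<odot>\<^bsub>M\<^esub> (I +> b)" if "a \<in> carrier R" "b \<in> carrier R" for a b
    using module_homD(3)[OF hom] that by (simp add: self_module_def)
  have surj: "\<exists>b\<in>carrier R. m = I +> b" if "m \<in> carrier M" for m
    using that rcos_module_hom(2)[OF I] unfolding M_def by blast
  have mem: "I +> b \<in> carrier M" if "b \<in> carrier R" for b
    using that rcos_module_hom(2)[OF I] unfolding M_def by blast
  have f: "fs ! j \<in> carrier R" using fs by auto
  have fsj: "set (take j fs) \<subseteq> carrier R" using fs(1) set_take_subset by fast
  show ?thesis
  proof
    assume "I +> p \<in> list_mult_module M (take (Suc j) fs)"
    then obtain y m where y: "y \<in> list_mult_module M (take j fs)" and m: "m \<in> carrier M"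
      and eq: "I +> p = y \<oplus>\<^bsub>M\<^esub> fs ! j \<odot>\<^bsub>M\<^esub> m"
      unfolding M.list_mult_module_take_Suc[OF fs] by blast
    obtain b where b: "b \<in> carrier R" "m = I +> b" using surj[OF m] by blast
    obtain c where c: "c \<in> carrier R" "y = I +> c"
      using surj[OF M.list_mult_module_closed[OF fsj y]] by blast
    let ?a = "p \<ominus> fs ! j \<otimes> b"
    have a: "?a \<in> carrier R" using p b f by simp
    have eqp: "p = ?a \<oplus> fs ! j \<otimes> b" using p b f by (simp add: minus_add_cancel)
    have "(I +> ?a) \<oplus>\<^bsub>M\<^esub> (I +> (fs ! j \<otimes> b)) = y \<oplus>\<^bsub>M\<^esub> (I +> (fs ! j \<otimes> b))"
      using eqp eq b f a by (metis add smult m_closed)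
    then have "I +> ?a = y"
      using mem[OF a] mem[of "fs ! j \<otimes> b"] mem[OF c(1)] c(2) f b(1) by simp
    then show "\<exists>a\<in>carrier R. \<exists>b\<in>carrier R. p = a \<oplus> fs ! j \<otimes> b \<and> I +> a \<in> list_mult_module M (take j fs)"
      using a b(1) eqp y by blast
  next
    assume "\<exists>a\<in>carrier R. \<exists>b\<in>carrier R. p = a \<oplus> fs ! j \<otimes> b \<and> I +> a \<in> list_mult_module M (take j fs)"
    then obtain a b where ab: "a \<in> carrier R" "b \<in> carrier R" "p = a \<oplus> fs ! j \<otimes> b"
      "I +> a \<in> list_mult_module M (take j fs)" by blast
    have "I +> p = (I +> a) \<oplus>\<^bsub>M\<^esub> fs ! j \<odot>\<^bsub>M\<^esub> (I +> b)"
      unfolding ab(3) using ab f by (simp add: add smult)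
    then show "I +> p \<in> list_mult_module M (take (Suc j) fs)"
      unfolding M.list_mult_module_take_Suc[OF fs] using ab(4) mem[OF ab(2)] by blast
  qed
qed

section \<open>Koszul homology and regular elements\<close>

text \<open>
  In characteristic 2 the diagonal terms do not vanish by antisymmetry and have to be assumed zero.
  For the same reason the terms are paired off rather than the sum compared with its negative.
\<close>

lemma sum_alternating_eq_0:
  fixes G :: "'v \<Rightarrow> 'v \<Rightarrow> 'a::ab_group_add"
  assumes "finite A" "\<And>v. v \<in> A \<Longrightarrow> G v v = 0"
    "\<And>v w. v \<in> A \<Longrightarrow> w \<in> A \<Longrightarrow> v \<noteq> w \<Longrightarrow> G w v = - G v w"
  shows "(\<Sum>v\<in>A. \<Sum>w\<in>A. G v w) = 0"
  using assms
proof (induction A)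
  case (insert a A)
  have "(\<Sum>v\<in>A. G v a) = (\<Sum>v\<in>A. - G a v)"
  proof (rule sum.cong[OF refl])
    fix v assume "v \<in> A"
    moreover from this have "a \<noteq> v" using insert.hyps(2) by blast
    ultimately show "G v a = - G a v" by (intro insert.prems(2)) simp_all
  qed
  then have 1: "(\<Sum>v\<in>A. G v a) = - (\<Sum>v\<in>A. G a v)" by (simp only: sum_negf)
  have 2: "(\<Sum>v\<in>A. \<Sum>w\<in>A. G v w) = 0"
  proof (rule insert.IH)
    show "G v v = 0" if "v \<in> A" for v using that by (intro insert.prems(1)) simp
    show "G w v = - G v w" if "v \<in> A" "w \<in> A" "v \<noteq> w" for v w
      using that by (intro insert.prems(2)) simp_all
  qed
  have "G a a = 0" by (rule insert.prems(1)) simp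
  then show ?case
    unfolding sum.insert[OF insert.hyps] sum.distrib 1 2 by simp
qed (simp only: sum.empty)

text \<open>
  The Koszul complex of the family \<open>x\<close>.  A chain maps a subset \<open>T\<close> of \<open>V\<close> to the coefficient of the
  basis element \<open>e\<^sub>T\<close> of the exterior algebra, and \<open>rank\<close> orders the factors of \<open>e\<^sub>T\<close>.  The
  coefficients come from a subring \<open>R\<close> of the type: for polynomials, those in the variables \<open>V\<close>.
\<close>

locale koszul =
  fixes rank :: "'v \<Rightarrow> nat" and V :: "'v set" and x :: "'v \<Rightarrow> 'a::comm_ring_1" and R :: "'a set"
  assumes finite_V: "finite V" and inj_rank: "inj_on rank V"
    and one_R: "1 \<in> R" and uminus_R: "a \<in> R \<Longrightarrow> - a \<in> R"
    and add_R: "a \<in> R \<Longrightarrow> b \<in> R \<Longrightarrow> a + b \<in> R"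
    and mult_R: "a \<in> R \<Longrightarrow> b \<in> R \<Longrightarrow> a * b \<in> R"
    and x_R: "v \<in> V \<Longrightarrow> x v \<in> R"
begin

lemma zero_R: "0 \<in> R" using add_R[OF one_R uminus_R[OF one_R]] by simp

lemma sum_R: "(\<And>i. i \<in> A \<Longrightarrow> g i \<in> R) \<Longrightarrow> sum g A \<in> R"
  by (induction A rule: infinite_finite_induct) (auto simp: zero_R add_R)

definition sign :: "'v \<Rightarrow> 'v set \<Rightarrow> 'a" where
  "sign v T = (- 1) ^ card {t \<in> T. rank t < rank v}"

definition boundary :: "('v set \<Rightarrow> 'a) \<Rightarrow> 'v set \<Rightarrow> 'a" where
  "boundary u T = (\<Sum>v\<in>V - T. sign v T * x v * u (insert v T))"

text \<open>
  This is exterior multiplication by \<open>e\<^sub>v\<close>.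
\<close>

definition homotopy :: "'v \<Rightarrow> ('v set \<Rightarrow> 'a) \<Rightarrow> 'v set \<Rightarrow> 'a" where
  "homotopy v u T = (if v \<in> T then sign v T * u (T - {v}) else 0)"

definition is_ideal :: "'a set \<Rightarrow> bool" where
  "is_ideal J \<longleftrightarrow> 0 \<in> J \<and> (\<forall>a\<in>J. \<forall>b\<in>J. a + b \<in> J) \<and> (\<forall>a\<in>R. \<forall>b\<in>J. a * b \<in> J)"

text \<open>
  The Koszul homology of \<open>R / J\<close> in degree \<open>i\<close> is nonzero: \<open>z\<close> is a chain of degree \<open>i\<close> that is a
  cycle, but not a boundary, modulo \<open>J\<close>.  A candidate \<open>u\<close> for a chain with boundary \<open>z\<close> may have
  components of all degrees; those outside degree \<open>i + 1\<close> do not affect the component of its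
  boundary in degree \<open>i\<close>.
\<close>

definition nonzero_homology :: "'a set \<Rightarrow> nat \<Rightarrow> bool" where
  "nonzero_homology J i \<longleftrightarrow>
     (\<exists>z. range z \<subseteq> R \<and> (\<forall>T\<subseteq>V. card T \<noteq> i \<longrightarrow> z T = 0) \<and> (\<forall>T\<subseteq>V. boundary z T \<in> J) \<and>
        (\<forall>u. range u \<subseteq> R \<longrightarrow> (\<exists>T\<subseteq>V. z T - boundary u T \<notin> J)))"

lemma sign_R: "sign v T \<in> R"
proof -
  have "(- 1 :: 'a) ^ n \<in> R" for n by (induction n) (auto simp: one_R uminus_R)
  then show ?thesis by (simp add: sign_def)
qed

lemma sign_square: "sign v T * sign v T = 1"
  by (simp add: sign_def flip: power_mult_distrib)

lemma sign_insert_gt: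
  assumes "T \<subseteq> V" "v \<notin> T" "rank v < rank w"
  shows "sign w (insert v T) = - sign w T"
proof -
  have "finite T" using finite_V assms(1) by (rule finite_subset[rotated])
  moreover have "{t \<in> insert v T. rank t < rank w} = insert v {t \<in> T. rank t < rank w}"
    using assms(3) by auto
  ultimately show ?thesis using assms(2) by (simp add: sign_def)
qed

lemma sign_insert_le:
  assumes "\<not> rank v < rank w"
  shows "sign w (insert v T) = sign w T"
proof -
  have "{t \<in> insert v T. rank t < rank w} = {t \<in> T. rank t < rank w}" using assms by auto
  then show ?thesis by (simp only: sign_def)
qed

lemma sign_swap:
  assumes "T \<subseteq> V" "v \<in> V - T" "w \<in> V - T" "v \<noteq> w"
  shows "sign w T * sign v (insert w T) = - (sign v T * sign w (insert v T))"
    and "sign w (insert v T) * sign v (insert w T) = - (sign v T * sign w T)"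
proof -
  have "rank v \<noteq> rank w" using assms inj_rank by (metis DiffD1 inj_onD)
  then consider "rank v < rank w" "\<not> rank w < rank v" | "rank w < rank v" "\<not> rank v < rank w"
    by linarith
  then have "(sign w (insert v T) = - sign w T \<and> sign v (insert w T) = sign v T) \<or>
      (sign w (insert v T) = sign w T \<and> sign v (insert w T) = - sign v T)"
    using assms sign_insert_gt sign_insert_le by cases blast+
  then show "sign w T * sign v (insert w T) = - (sign v T * sign w (insert v T))"
    and "sign w (insert v T) * sign v (insert w T) = - (sign v T * sign w T)"
    by (auto simp: mult.commute)
qed

lemma boundary_boundary:
  assumes "T \<subseteq> V"
  shows "boundary (boundary u) T = 0"
proof -
  let ?G = "\<lambda>v w. if v = w then 0 else
    (sign v T * sign w (insert v T)) * (x v * x w) * u (insert v (insert w T))"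
  have "boundary (boundary u) T = (\<Sum>v\<in>V - T. \<Sum>w\<in>V - T. ?G v w)"
    unfolding boundary_def
  proof (rule sum.cong[OF refl])
    fix v assume v: "v \<in> V - T"
    have "(\<Sum>w\<in>V - T. ?G v w) = (\<Sum>w\<in>V - insert v T. ?G v w)"
      using v finite_V by (intro sum.mono_neutral_right) auto
    also have "\<dots> = (\<Sum>w\<in>V - insert v T.
        sign v T * x v * (sign w (insert v T) * x w * u (insert w (insert v T))))"
      by (rule sum.cong) (auto simp: insert_commute mult_ac)
    finally show "sign v T * x v * (\<Sum>w\<in>V - insert v T. sign w (insert v T) * x w * u (insert w (insert v T)))
        = (\<Sum>w\<in>V - T. ?G v w)"
      by (simp add: sum_distrib_left)
  qed
  also have "\<dots> = 0"
  proof (rule sum_alternating_eq_0)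
    fix v w assume "v \<in> V - T" "w \<in> V - T" "v \<noteq> w"
    then show "?G w v = - ?G v w"
      using sign_swap(1)[OF assms, of v w] by (simp add: insert_commute mult.commute[of "x v"])
  qed (use finite_V in auto)
  finally show ?thesis .
qed

text \<open>
  Multiplication by \<open>x v\<close> is homotopic to zero.  Hence each element of the ideal of the \<open>x v\<close>
  annihilates Koszul homology.
\<close>

lemma homotopy_formula:
  assumes "T \<subseteq> V" "v \<in> V"
  shows "boundary (homotopy v u) T + homotopy v (boundary u) T = x v * u T"
proof (cases "v \<in> T")
  case False
  have "boundary (homotopy v u) T = (\<Sum>w\<in>{v}. sign w T * x w * homotopy v u (insert w T))"
    unfolding boundary_def
    by (rule sum.mono_neutral_right) (use finite_V assms False in \<open>auto simp: homotopy_def\<close>)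
  also have "\<dots> = (sign v T * sign v T) * x v * u T"
    using False by (simp add: homotopy_def sign_insert_le mult_ac)
  finally show ?thesis using False by (simp add: sign_square homotopy_def)
next
  case True
  define T' where "T' = T - {v}"
  have T: "T = insert v T'" "v \<notin> T'" "T' \<subseteq> V" using True assms by (auto simp: T'_def)
  have ins: "V - T' = insert v (V - T)" using True assms by (auto simp: T'_def)
  have sv: "sign v T = sign v T'" by (simp add: T(1) sign_insert_le)
  have "boundary (homotopy v u) T =
      (\<Sum>w\<in>V - T. sign w T * x w * (sign v (insert w T) * u (insert w T')))"
    unfolding boundary_def
  proof (rule sum.cong[OF refl])
    fix w assume w: "w \<in> V - T"
    then have "insert w T - {v} = insert w T'" using True by (auto simp: T'_def)
    then show "sign w T * x w * homotopy v u (insert w T)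
        = sign w T * x w * (sign v (insert w T) * u (insert w T'))"
      using True by (simp add: homotopy_def)
  qed
  also have "\<dots> = (\<Sum>w\<in>V - T. - (sign v T' * (sign w T' * x w * u (insert w T'))))"
  proof (rule sum.cong[OF refl])
    fix w assume w: "w \<in> V - T"
    then have wT': "w \<in> V - T'" "v \<in> V - T'" "v \<noteq> w" using T assms(2) by auto
    have "sign v (insert w T) = sign v (insert w T')"
      by (simp add: T(1) insert_commute[of w] sign_insert_le)
    then have "sign w T * x w * (sign v (insert w T) * u (insert w T')) =
        (sign w (insert v T') * sign v (insert w T')) * (x w * u (insert w T'))"
      by (simp add: T(1) mult_ac)
    also have "\<dots> = - (sign v T' * (sign w T' * x w * u (insert w T')))"
      unfolding sign_swap(2)[OF T(3) wT'(2,1,3)] by (simp add: mult_ac)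
    finally show "sign w T * x w * (sign v (insert w T) * u (insert w T')) =
        - (sign v T' * (sign w T' * x w * u (insert w T')))" .
  qed
  also have "\<dots> = - (sign v T' * (\<Sum>w\<in>V - T. sign w T' * x w * u (insert w T')))"
    by (simp add: sum_negf sum_distrib_left)
  finally have 1: "boundary (homotopy v u) T = \<dots>" .
  have "homotopy v (boundary u) T =
      sign v T' * (sign v T' * x v * u T + (\<Sum>w\<in>V - T. sign w T' * x w * u (insert w T')))"
    using True finite_V by (simp add: homotopy_def sv boundary_def ins flip: T'_def) (simp add: T(1))
  also have "\<dots> = (sign v T' * sign v T') * x v * u T
      + sign v T' * (\<Sum>w\<in>V - T. sign w T' * x w * u (insert w T'))"
    by (simp add: algebra_simps)
  finally show ?thesis unfolding 1 by (simp add: sign_square)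
qed

lemma boundary_R: "range u \<subseteq> R \<Longrightarrow> boundary u T \<in> R"
  unfolding boundary_def by (intro sum_R mult_R sign_R x_R) auto

lemma is_ideal_sum:
  assumes "is_ideal J" "\<And>i. i \<in> A \<Longrightarrow> g i \<in> J"
  shows "sum g A \<in> J"
  using assms by (induction A rule: infinite_finite_induct) (auto simp: is_ideal_def)

lemma boundary_cong:
  assumes "T \<subseteq> V" "\<And>S. S \<subseteq> V \<Longrightarrow> u S = w S"
  shows "boundary u T = boundary w T"
  unfolding boundary_def using assms by (intro sum.cong refl) simp

lemma boundary_ideal:
  assumes "is_ideal J" "T \<subseteq> V" "\<And>T. T \<subseteq> V \<Longrightarrow> u T \<in> J"
  shows "boundary u T \<in> J"
  unfolding boundary_def
proof (rule is_ideal_sum[OF assms(1)])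
  fix v assume "v \<in> V - T"
  then have "sign v T * x v \<in> R" "u (insert v T) \<in> J"
    using assms(2,3) by (auto intro!: mult_R sign_R x_R)
  then show "sign v T * x v * u (insert v T) \<in> J" using assms(1) by (simp add: is_ideal_def)
qed

lemma boundary_linear:
  "boundary (\<lambda>T. a * u T + w T) T = a * boundary u T + boundary w T"
  by (simp add: boundary_def algebra_simps sum.distrib sum_distrib_left)

lemma boundary_combination:
  "boundary (\<lambda>T. \<Sum>v\<in>A. g v * u v T) T = (\<Sum>v\<in>A. g v * boundary (u v) T)"
proof -
  have "boundary (\<lambda>T. \<Sum>v\<in>A. g v * u v T) T =
      (\<Sum>w\<in>V - T. \<Sum>v\<in>A. g v * (sign w T * x w * u v (insert w T)))"
    unfolding boundary_def by (simp add: sum_distrib_left mult_ac)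
  also have "\<dots> = (\<Sum>v\<in>A. \<Sum>w\<in>V - T. g v * (sign w T * x w * u v (insert w T)))"
    by (rule sum.swap)
  finally show ?thesis unfolding boundary_def by (simp add: sum_distrib_left)
qed

text \<open>
  If \<open>z\<close> is a cycle modulo \<open>J\<close>, then \<open>f z\<close> is the boundary modulo \<open>J\<close> of a chain \<open>u\<close> that the
  homotopies provide, since \<open>f\<close> is a combination of the \<open>x v\<close>.  Modulo \<open>J' = J + (f)\<close> this \<open>u\<close> is a
  cycle in the next degree.  If it were a boundary up to some \<open>f b\<close>, then \<open>f z\<close> would be the
  boundary of \<open>f b\<close> modulo \<open>J\<close>, and cancelling \<open>f\<close> would make \<open>z\<close> the boundary of \<open>b\<close>.
\<close>

lemma nonzero_homology_regular_element:
  assumes J: "is_ideal J" and f: "f = (\<Sum>v\<in>V. x v * g v)" "\<And>v. v \<in> V \<Longrightarrow> g v \<in> R"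
    and reg: "\<And>a. a \<in> R \<Longrightarrow> f * a \<in> J \<Longrightarrow> a \<in> J"
    and J': "J' = {a + f * b |a b. a \<in> J \<and> b \<in> R}"
    and nz: "nonzero_homology J i"
  shows "nonzero_homology J' (Suc i)"
proof -
  from nz obtain z where z: "range z \<subseteq> R" "\<And>T. T \<subseteq> V \<Longrightarrow> card T \<noteq> i \<Longrightarrow> z T = 0"
    and cyc: "\<And>T. T \<subseteq> V \<Longrightarrow> boundary z T \<in> J"
    and nb: "\<And>u. range u \<subseteq> R \<Longrightarrow> \<exists>T\<subseteq>V. z T - boundary u T \<notin> J"
    unfolding nonzero_homology_def by auto
  have Jadd: "a + b \<in> J" if "a \<in> J" "b \<in> J" for a b using J that by (auto simp: is_ideal_def)
  have Jmult: "a * b \<in> J" if "a \<in> R" "b \<in> J" for a b using J that by (auto simp: is_ideal_def)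
  have Jneg: "- a \<in> J" if "a \<in> J" for a using Jmult[OF uminus_R[OF one_R] that] by simp
  have Jdiff: "a - b \<in> J" if "a \<in> J" "b \<in> J" for a b using Jadd[OF that(1) Jneg[OF that(2)]] by simp
  define u where "u T = (\<Sum>v\<in>V. g v * homotopy v z T)" for T
  have hR: "homotopy v w T \<in> R" if "range w \<subseteq> R" for v w T
    using that by (auto simp: homotopy_def zero_R intro!: mult_R sign_R)
  have uR: "range u \<subseteq> R" unfolding u_def using f(2) hR[OF z(1)] by (auto intro!: sum_R mult_R)
  have hJ: "(\<Sum>v\<in>V. g v * homotopy v (boundary z) T) \<in> J" if T: "T \<subseteq> V" for T
  proof (rule is_ideal_sum[OF J])
    fix v assume v: "v \<in> V"
    have "boundary z (T - {v}) \<in> J" using cyc T by (meson Diff_subset subset_trans)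
    then have "homotopy v (boundary z) T \<in> J"
      using J by (auto simp: homotopy_def is_ideal_def sign_R)
    then show "g v * homotopy v (boundary z) T \<in> J" using Jmult f(2)[OF v] by blast
  qed
  have bu: "f * z T = boundary u T + (\<Sum>v\<in>V. g v * homotopy v (boundary z) T)" if T: "T \<subseteq> V" for T
  proof -
    have "boundary u T + (\<Sum>v\<in>V. g v * homotopy v (boundary z) T) =
        (\<Sum>v\<in>V. g v * (boundary (homotopy v z) T + homotopy v (boundary z) T))"
      unfolding u_def boundary_combination by (simp add: sum.distrib distrib_left)
    also have "\<dots> = (\<Sum>v\<in>V. g v * (x v * z T))"
      by (intro sum.cong refl) (simp add: homotopy_formula T)
    finally show ?thesis by (simp add: f(1) sum_distrib_left sum_distrib_right mult_ac)
  qed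
  show ?thesis
    unfolding nonzero_homology_def
  proof (intro exI[of _ u] conjI allI impI)
    show "range u \<subseteq> R" by fact
  next
    fix T assume T: "T \<subseteq> V" "card T \<noteq> Suc i"
    have "homotopy v z T = 0" for v
    proof (cases "v \<in> T")
      case True
      then have "card (T - {v}) \<noteq> i"
        using T finite_subset[OF T(1) finite_V] by (metis card_Suc_Diff1)
      then have "z (T - {v}) = 0" using T(1) by (intro z(2)) auto
      then show ?thesis by (simp add: homotopy_def)
    qed (simp add: homotopy_def)
    then show "u T = 0" by (simp add: u_def)
  next
    fix T assume T: "T \<subseteq> V"
    have "boundary u T = - (\<Sum>v\<in>V. g v * homotopy v (boundary z) T) + f * z T"
      using bu[OF T] by (simp add: algebra_simps)
    moreover have "z T \<in> R" using z(1) by blast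
    ultimately show "boundary u T \<in> J'" using Jneg[OF hJ[OF T]] unfolding J' by blast
  next
    fix t :: "'v set \<Rightarrow> 'a" assume t: "range t \<subseteq> R"
    show "\<exists>T\<subseteq>V. u T - boundary t T \<notin> J'"
    proof (rule ccontr)
      assume "\<not> ?thesis"
      then have "\<exists>a b. a \<in> J \<and> b \<in> R \<and> u T - boundary t T = a + f * b" if "T \<subseteq> V" for T
        using that unfolding J' by blast
      then obtain a b where ab: "\<And>T. T \<subseteq> V \<Longrightarrow> a T \<in> J \<and> b T \<in> R \<and> u T - boundary t T = a T + f * b T"
        by metis
      define c where "c T = (if T \<subseteq> V then b T else 0)" for T
      have c: "range c \<subseteq> R" using ab zero_R by (auto simp: c_def)
      have "z T - boundary c T \<in> J" if T: "T \<subseteq> V" for T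
      proof -
        have "boundary u T = boundary (\<lambda>T. f * c T + (1 * boundary t T + a T)) T"
        proof (rule boundary_cong[OF T])
          fix S assume "S \<subseteq> V"
          then show "u S = f * c S + (1 * boundary t S + a S)"
            using ab by (simp add: c_def algebra_simps)
        qed
        also have "\<dots> = f * boundary c T + boundary a T"
          unfolding boundary_linear using boundary_boundary[OF T] by simp
        finally have "f * (z T - boundary c T) =
            boundary a T + (\<Sum>v\<in>V. g v * homotopy v (boundary z) T)"
          using bu[OF T] by (simp add: algebra_simps)
        also have "\<dots> \<in> J"
          using boundary_ideal[OF J T, of a] ab hJ[OF T] Jadd by blast
        finally show ?thesis
          using reg[of "z T - boundary c T"] z(1) boundary_R[OF c, of T] add_R uminus_R
          by (metis diff_conv_add_uminus range_subsetD)
      qed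
      then show False using nb[OF c] by blast
    qed
  qed
qed

lemma nonzero_homology_le_card:
  assumes "is_ideal J" "nonzero_homology J i"
  shows "i \<le> card V"
proof (rule ccontr)
  assume i: "\<not> i \<le> card V"
  from assms(2) obtain z where z: "\<And>T. T \<subseteq> V \<Longrightarrow> card T \<noteq> i \<Longrightarrow> z T = 0"
    and nb: "\<And>u. range u \<subseteq> R \<Longrightarrow> \<exists>T\<subseteq>V. z T - boundary u T \<notin> J"
    unfolding nonzero_homology_def by auto
  have "z T = 0" if "T \<subseteq> V" for T
    using z[OF that] card_mono[OF finite_V that] i by auto
  moreover have "boundary (\<lambda>_. 0) T = 0" for T by (simp add: boundary_def)
  ultimately show False using nb[of "\<lambda>_. 0"] zero_R assms(1) by (auto simp: is_ideal_def)
qed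

lemma nonzero_homology_add_length_le:
  assumes ideal: "\<And>j. j \<le> d \<Longrightarrow> is_ideal (J j)"
    and f: "\<And>j. j < d \<Longrightarrow> \<exists>g. (\<forall>v\<in>V. g v \<in> R) \<and> f j = (\<Sum>v\<in>V. x v * g v)"
    and reg: "\<And>j a. j < d \<Longrightarrow> a \<in> R \<Longrightarrow> f j * a \<in> J j \<Longrightarrow> a \<in> J j"
    and Suc: "\<And>j. j < d \<Longrightarrow> J (Suc j) = {a + f j * b |a b. a \<in> J j \<and> b \<in> R}"
    and nz: "nonzero_homology (J 0) i"
  shows "i + d \<le> card V"
proof -
  have "nonzero_homology (J j) (i + j)" if "j \<le> d" for j
    using that
  proof (induction j)
    case (Suc j)
    then have j: "j < d" by simp
    obtain g where "\<And>v. v \<in> V \<Longrightarrow> g v \<in> R" "f j = (\<Sum>v\<in>V. x v * g v)"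
      using f[OF j] by blast
    then show ?case
      using nonzero_homology_regular_element[OF ideal _ _ reg[OF j] assms(4)[OF j], of g "i + j"] Suc.IH j
      by simp
  qed (simp add: nz)
  then show ?thesis using nonzero_homology_le_card[OF ideal] by blast
qed

end

section \<open>Polynomial rings and monomial ideals\<close>

abbreviation lookup where "lookup \<equiv> Poly_Mapping.lookup"
abbreviation keys where "keys \<equiv> Poly_Mapping.keys"
abbreviation monomial where "monomial \<equiv> Poly_Mapping.single"

lemma mpoly_ring_simps [simp]:
  "mult (mpoly_ring V) = (*)" "one (mpoly_ring V) = 1"
  "zero (mpoly_ring V) = 0" "add (mpoly_ring V) = (+)"
  by (simp_all add: mpoly_ring_def)

lemma mem_carrier_mpoly_ring:
  "p \<in> carrier (mpoly_ring V) \<longleftrightarrow> (\<forall>t\<in>keys p. keys t \<subseteq> V)"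
  by (simp add: mpoly_ring_def)

lemma carrier_mpoly_ring_closed:
  fixes p q :: "('v, 'k::field) mpoly"
  shows "1 \<in> carrier (mpoly_ring V :: ('v, 'k) mpoly ring)"
    and "p \<in> carrier (mpoly_ring V) \<Longrightarrow> - p \<in> carrier (mpoly_ring V)"
    and "p \<in> carrier (mpoly_ring V) \<Longrightarrow> q \<in> carrier (mpoly_ring V) \<Longrightarrow> p + q \<in> carrier (mpoly_ring V)"
    and "p \<in> carrier (mpoly_ring V) \<Longrightarrow> q \<in> carrier (mpoly_ring V) \<Longrightarrow> p * q \<in> carrier (mpoly_ring V)"
proof -
  show "1 \<in> carrier (mpoly_ring V :: ('v, 'k) mpoly ring)"
    and "p \<in> carrier (mpoly_ring V) \<Longrightarrow> - p \<in> carrier (mpoly_ring V)"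
    by (auto simp: mem_carrier_mpoly_ring)
  assume p: "p \<in> carrier (mpoly_ring V)" "q \<in> carrier (mpoly_ring V)"
  show "p + q \<in> carrier (mpoly_ring V)"
    using p keys_add[of p q] unfolding mem_carrier_mpoly_ring by blast
  show "p * q \<in> carrier (mpoly_ring V)"
    unfolding mem_carrier_mpoly_ring
  proof
    fix t assume "t \<in> keys (p * q)"
    then obtain a b where "t = a + b" "a \<in> keys p" "b \<in> keys q" using keys_mult[of p q] by blast
    then show "keys t \<subseteq> V" using p keys_add[of a b] unfolding mem_carrier_mpoly_ring by blast
  qed
qed

lemma cring_mpoly_ring: "cring (mpoly_ring V :: ('v, 'k::field) mpoly ring)"
proof (rule cringI)
  show "abelian_group (mpoly_ring V :: ('v, 'k) mpoly ring)"
  proof (rule abelian_groupI)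
    fix p :: "('v, 'k) mpoly" assume "p \<in> carrier (mpoly_ring V)"
    then show "\<exists>q\<in>carrier (mpoly_ring V). q \<oplus>\<^bsub>mpoly_ring V\<^esub> p = \<zero>\<^bsub>mpoly_ring V\<^esub>"
      using carrier_mpoly_ring_closed(2) by (intro bexI[of _ "- p"]) auto
  qed (auto simp: carrier_mpoly_ring_closed add_ac, simp add: mem_carrier_mpoly_ring)
  show "comm_monoid (mpoly_ring V :: ('v, 'k) mpoly ring)"
    by (rule comm_monoidI) (auto simp: carrier_mpoly_ring_closed mult_ac)
qed (simp add: distrib_right)

lemma monomial_in_carrier: "keys t \<subseteq> V \<Longrightarrow> monomial t c \<in> carrier (mpoly_ring V)"
  by (simp add: mem_carrier_mpoly_ring)

lemma var_in_carrier: "v \<in> V \<Longrightarrow> var v \<in> carrier (mpoly_ring V)"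
  by (simp add: var_def monomial_in_carrier)

lemma sum_in_carrier:
  assumes "\<And>i. i \<in> A \<Longrightarrow> g i \<in> carrier (mpoly_ring V)"
  shows "sum g A \<in> carrier (mpoly_ring V)"
  using assms
  by (induction A rule: infinite_finite_induct)
    (auto simp: carrier_mpoly_ring_closed, simp_all add: mem_carrier_mpoly_ring)

lemma lookup_var_mult:
  fixes p :: "('v, 'k::field) mpoly"
  shows "lookup (var v * p) (monomial v 1 + t) = lookup p t"
  by (simp add: var_def lookup_mult lookup_single when_mult)

text \<open>
  Since the ideal that monomials with exponents in \<open>Q\<close> generate is contained in this one, all
  exponents of its elements are in \<open>Q\<close>.
\<close>

lemma ideal_of_monomials:
  assumes up: "\<And>s t. t \<in> Q \<Longrightarrow> s + t \<in> Q"
  shows "ideal {p \<in> carrier (mpoly_ring V). keys p \<subseteq> Q} (mpoly_ring V :: ('v, 'k::field) mpoly ring)"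
    (is "ideal ?I ?S")
proof -
  interpret S: cring ?S by (rule cring_mpoly_ring)
  have mult: "keys (q * p) \<subseteq> Q" if "keys p \<subseteq> Q" for p q :: "('v, 'k) mpoly"
  proof
    fix t assume "t \<in> keys (q * p)"
    then obtain a b where "t = a + b" "b \<in> keys p" using keys_mult[of q p] by blast
    then show "t \<in> Q" using that up by blast
  qed
  have inv: "\<ominus>\<^bsub>?S\<^esub> p = - p" if "p \<in> carrier ?S" for p :: "('v, 'k) mpoly"
    using that S.minus_equality[of "- p" p] carrier_mpoly_ring_closed(2)[of p V] by simp
  show ?thesis
  proof (rule idealI)
    show "ring ?S" by (rule S.ring_axioms)
    show "subgroup ?I (add_monoid ?S)"
    proof (rule S.add.subgroupI)
      have "0 \<in> ?I" by (simp add: mem_carrier_mpoly_ring)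
      then show "?I \<noteq> {}" by blast
      fix p q assume p: "p \<in> ?I"
      then show "\<ominus>\<^bsub>?S\<^esub> p \<in> ?I" by (simp add: inv carrier_mpoly_ring_closed(2))
      assume q: "q \<in> ?I"
      then show "p \<oplus>\<^bsub>?S\<^esub> q \<in> ?I"
        using p keys_add[of p q] by (auto simp: carrier_mpoly_ring_closed(3))
    qed auto
    fix p q assume "p \<in> ?I" "q \<in> carrier ?S"
    then show "q \<otimes>\<^bsub>?S\<^esub> p \<in> ?I" "p \<otimes>\<^bsub>?S\<^esub> q \<in> ?I"
      using mult[of p q] by (auto simp: carrier_mpoly_ring_closed(4) mult.commute)
  qed
qed

lemma var_division:
  fixes p :: "('v, 'k::field) mpoly"
  assumes "p \<in> carrier (mpoly_ring V)"
  shows "\<exists>q\<in>carrier (mpoly_ring V). \<exists>r\<in>carrier (mpoly_ring V).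
    p = r + var v * q \<and> keys r = {t \<in> keys p. lookup t v = 0}"
proof -
  let ?K = "{t \<in> keys p. lookup t v > 0}"
  let ?q = "\<Sum>t\<in>?K. monomial (t - monomial v 1) (lookup p t)"
  let ?r = "\<Sum>t\<in>keys p - ?K. monomial t (lookup p t)"
  have "keys (t - monomial v 1) \<subseteq> V" if "t \<in> keys p" for t
  proof -
    have "keys (t - monomial v 1) \<subseteq> keys t" by (auto simp: in_keys_iff lookup_minus)
    then show ?thesis using that assms unfolding mem_carrier_mpoly_ring by blast
  qed
  then have q: "?q \<in> carrier (mpoly_ring V)"
    by (intro sum_in_carrier monomial_in_carrier) blast
  have look: "lookup ?r s = (if s \<in> keys p - ?K then lookup p s else 0)" for s
    by (simp add: lookup_sum lookup_single when_def)
  have kr: "keys ?r = {t \<in> keys p. lookup t v = 0}"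
  proof (rule Set.set_eqI)
    fix s
    show "s \<in> keys ?r \<longleftrightarrow> s \<in> {t \<in> keys p. lookup t v = 0}"
      unfolding in_keys_iff[of s ?r] look by (auto simp: in_keys_iff)
  qed
  have split: "monomial v 1 + (t - monomial v 1) = t" if "lookup t v > 0" for t :: "'v \<Rightarrow>\<^sub>0 nat"
    by (rule poly_mapping_eqI) (use that in \<open>auto simp: lookup_add lookup_minus lookup_single when_def\<close>)
  have "var v * ?q = (\<Sum>t\<in>?K. monomial t (lookup p t))"
    unfolding sum_distrib_left by (rule sum.cong) (simp_all add: var_def mult_single split[simplified])
  then have "?r + var v * ?q = (\<Sum>t\<in>keys p. monomial t (lookup p t))"
    using sum.subset_diff[of ?K "keys p" "\<lambda>t. monomial t (lookup p t)"] by simp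
  also have "\<dots> = p"
    by (rule poly_mapping_eqI) (auto simp: lookup_sum lookup_single when_def in_keys_iff)
  finally have "p = ?r + var v * ?q" by simp
  moreover have "?r \<in> carrier (mpoly_ring V)"
    using assms unfolding mem_carrier_mpoly_ring kr by blast
  ultimately show ?thesis using q kr by blast
qed

lemma sum_var_mult_of_keys:
  fixes p :: "('v, 'k::field) mpoly"
  assumes "finite A" "p \<in> carrier (mpoly_ring V)" "\<And>t. t \<in> keys p \<Longrightarrow> \<exists>v\<in>A. lookup t v > 0"
  shows "\<exists>g. (\<forall>v\<in>A. g v \<in> carrier (mpoly_ring V)) \<and> p = (\<Sum>v\<in>A. var v * g v)"
  using assms
proof (induction A arbitrary: p)
  case empty
  then have "keys p = {}" by fast
  then show ?case by simp
next
  case (insert a A)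
  obtain q r where q: "q \<in> carrier (mpoly_ring V)" and r: "r \<in> carrier (mpoly_ring V)"
    and p: "p = r + var a * q" and kr: "keys r = {t \<in> keys p. lookup t a = 0}"
    using var_division[OF insert.prems(1)] by blast
  have "\<exists>v\<in>A. lookup t v > 0" if "t \<in> keys r" for t
    using insert.prems(2)[of t] that unfolding kr by auto
  then obtain g where g: "\<forall>v\<in>A. g v \<in> carrier (mpoly_ring V)" "r = (\<Sum>v\<in>A. var v * g v)"
    using insert.IH[OF r] by blast
  have "(\<Sum>v\<in>A. var v * (g(a := q)) v) = (\<Sum>v\<in>A. var v * g v)"
    by (rule sum.cong) (use insert.hyps in auto)
  then have "p = (\<Sum>v\<in>insert a A. var v * (g(a := q)) v)"
    using insert.hyps p g(2) by (simp add: add.commute)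
  then show ?case using g(1) q by (intro exI[of _ "g(a := q)"]) auto
qed

lemma list_mult_self_module_vars:
  assumes "set vs \<subseteq> V"
  shows "list_mult_module (self_module (mpoly_ring V :: ('v, 'k::field) mpoly ring)) (map var vs) =
    {p \<in> carrier (mpoly_ring V). \<forall>t\<in>keys p. \<exists>v\<in>set vs. lookup t v > 0}"
    (is "list_mult_module ?M _ = _")
proof -
  interpret S: cring "mpoly_ring V :: ('v, 'k) mpoly ring" by (rule cring_mpoly_ring)
  interpret M: module "mpoly_ring V" ?M by (rule S.module_self_module)
  show ?thesis
    using assms
  proof (induction vs rule: rev_induct)
    case Nil
    have "p = 0" if "\<forall>t\<in>keys p. False" for p :: "('v, 'k) mpoly"
      using that keys_eq_empty by blast
    then show ?case
      unfolding list.map M.list_mult_module_Nil by (auto simp: self_module_def mem_carrier_mpoly_ring)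
  next
    case (snoc w vs)
    have vs: "set (map var vs) \<subseteq> carrier (mpoly_ring V :: ('v, 'k) mpoly ring)"
      "var w \<in> carrier (mpoly_ring V :: ('v, 'k) mpoly ring)"
      using snoc.prems by (auto simp: var_in_carrier)
    have IH: "list_mult_module ?M (map var vs) =
        {p \<in> carrier (mpoly_ring V). \<forall>t\<in>keys p. \<exists>v\<in>set vs. lookup t v > 0}"
      using snoc by simp
    have "list_mult_module ?M (map var (vs @ [w])) =
        {a + var w * b |a b. a \<in> list_mult_module ?M (map var vs) \<and> b \<in> carrier (mpoly_ring V)}"
      using M.list_mult_module_snoc[OF vs] by (simp add: self_module_def)
    also have "\<dots> = {p \<in> carrier (mpoly_ring V). \<forall>t\<in>keys p. \<exists>v\<in>set (vs @ [w]). lookup t v > 0}"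
      (is "?L = ?R")
    proof (intro equalityI subsetI)
      fix p assume "p \<in> ?L"
      then obtain a b where p: "p = a + var w * b" and a: "a \<in> carrier (mpoly_ring V)"
        "\<And>t. t \<in> keys a \<Longrightarrow> \<exists>v\<in>set vs. lookup t v > 0"
        and b: "b \<in> carrier (mpoly_ring V)"
        unfolding IH by blast
      have "\<exists>v\<in>set (vs @ [w]). lookup t v > 0" if "t \<in> keys p" for t
      proof (cases "t \<in> keys a")
        case False
        then have "t \<in> keys (var w * b)" using that keys_add[of a "var w * b"] unfolding p by blast
        then obtain s where "t = monomial w 1 + s"
          using keys_mult[of "var w" b] by (auto simp: var_def)
        then show ?thesis by (auto simp: lookup_add)
      qed (use a(2) in auto)
      then show "p \<in> ?R" using a(1) b vs(2) unfolding p by (auto intro: carrier_mpoly_ring_closed)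
    next
      fix p assume p: "p \<in> ?R"
      then obtain q r where q: "q \<in> carrier (mpoly_ring V)" and r: "r \<in> carrier (mpoly_ring V)"
        and eq: "p = r + var w * q" and kr: "keys r = {t \<in> keys p. lookup t w = 0}"
        using var_division[of p V w] by blast
      have "r \<in> list_mult_module ?M (map var vs)"
        using p r kr unfolding IH by fastforce
      then show "p \<in> ?L" using q eq by blast
    qed
    finally show ?case .
  qed
qed

text \<open>
  Multiplication by a variable shifts the exponents in the direction of that variable only, so it
  cannot bring a polynomial into an ideal that is generated by other variables.
\<close>

lemma weakly_regular_vars:
  assumes "distinct vs" "set vs \<subseteq> V"
  shows "weakly_regular (mpoly_ring V) (self_module (mpoly_ring V :: ('v, 'k::field) mpoly ring)) (map var vs)"
  unfolding weakly_regular_def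
proof (intro allI impI ballI)
  fix j and p :: "('v, 'k) mpoly"
  assume "j < length (map var vs)"
  then have j: "j < length vs" by simp
  assume p: "p \<in> carrier (self_module (mpoly_ring V))"
  have tj: "set (take j vs) \<subseteq> V" using assms(2) set_take_subset by fast
  let ?v = "vs ! j"
  assume *: "map var vs ! j \<odot>\<^bsub>self_module (mpoly_ring V)\<^esub> p
    \<in> list_mult_module (self_module (mpoly_ring V)) (take j (map var vs))"
  have fresh: "w \<noteq> ?v" if "w \<in> set (take j vs)" for w
    using that assms(1) j by (auto simp: in_set_conv_nth nth_eq_iff_index_eq)
  have "\<exists>w\<in>set (take j vs). lookup t w > 0" if "t \<in> keys p" for t
  proof -
    have "monomial ?v 1 + t \<in> keys (var ?v * p)"
      using that unfolding in_keys_iff lookup_var_mult .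
    then obtain w where w: "w \<in> set (take j vs)" "lookup (monomial ?v 1 + t) w > 0"
      using * j unfolding take_map list_mult_self_module_vars[OF tj] by (auto simp: self_module_def)
    then show ?thesis using fresh[OF w(1)] by (auto simp: lookup_add lookup_single when_def)
  qed
  then show "p \<in> list_mult_module (self_module (mpoly_ring V)) (take j (map var vs))"
    using p unfolding take_map list_mult_self_module_vars[OF tj] by (simp add: self_module_def)
qed

section \<open>Homological bounds for quotients of polynomial rings\<close>

text \<open>
  The class of \<open>w\<close> is the nonzero element of the quotient that a regular sequence of variables
  annihilates.
\<close>

lemma proj_dim_ge_card_annihilating_vars:
  fixes I :: "('v, 'k::field) mpoly set"
  assumes I: "ideal I (mpoly_ring V)" and B: "finite B" "B \<subseteq> V"
    and w: "w \<in> carrier (mpoly_ring V)" "w \<notin> I" "\<And>v. v \<in> B \<Longrightarrow> var v * w \<in> I"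
  shows "enat (card B) \<le> proj_dim TYPE('u) (mpoly_ring V) (quotient_module (mpoly_ring V) I)"
proof -
  let ?S = "mpoly_ring V :: ('v, 'k) mpoly ring"
  let ?M = "quotient_module ?S I"
  interpret S: cring ?S by (rule cring_mpoly_ring)
  interpret I: ideal I ?S by (rule I)
  note hom = S.rcos_module_hom[OF I]
  obtain vs where vs: "set vs = B" "distinct vs" using finite_distinct_list[OF B(1)] by blast
  have zero: "I +>\<^bsub>?S\<^esub> p = \<zero>\<^bsub>?M\<^esub> \<longleftrightarrow> p \<in> I" if "p \<in> carrier ?S" for p
    unfolding hom(3) using that by (metis I.a_rcos_const I.a_rcos_self)
  have "enat (length (map var vs :: ('v, 'k) mpoly list)) \<le> proj_dim TYPE('u) ?S ?M"
  proof (rule proj_dim_ge_length_regular_annihilator[where m = "I +>\<^bsub>?S\<^esub> w"])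
    show "cring ?S" by (rule S.cring_axioms)
    show "set (map var vs) \<subseteq> carrier ?S" using vs(1) B(2) by (auto intro: var_in_carrier)
    show "weakly_regular ?S (self_module ?S) (map var vs)"
      by (rule weakly_regular_vars) (use vs B(2) in auto)
    show "I +>\<^bsub>?S\<^esub> w \<in> carrier ?M" using hom(2) w(1) by blast
    show "I +>\<^bsub>?S\<^esub> w \<noteq> \<zero>\<^bsub>?M\<^esub>" using zero[OF w(1)] w(2) by simp
    fix j assume "j < length (map var vs :: ('v, 'k) mpoly list)"
    then have j: "j < length vs" by simp
    then have v: "vs ! j \<in> B" using vs(1) by auto
    then have vc: "var (vs ! j) \<in> carrier ?S" using B(2) by (auto intro: var_in_carrier)
    have "map var vs ! j \<odot>\<^bsub>?M\<^esub> (I +>\<^bsub>?S\<^esub> w) = I +>\<^bsub>?S\<^esub> (var (vs ! j) * w)"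
      using module_homD(3)[OF hom(1) vc, of w] w(1) j by (simp add: self_module_def)
    also have "\<dots> = \<zero>\<^bsub>?M\<^esub>"
      using zero[of "var (vs ! j) * w"] w(3)[OF v] I.a_Hcarr by blast
    finally show "map var vs ! j \<odot>\<^bsub>?M\<^esub> (I +>\<^bsub>?S\<^esub> w) = \<zero>\<^bsub>?M\<^esub>" .
  qed
  then show ?thesis using vs distinct_card by force
qed

lemma koszul_mpoly_ring:
  assumes "finite V" "inj_on rank V"
  shows "koszul rank V (var :: 'v \<Rightarrow> ('v, 'k::field) mpoly) (carrier (mpoly_ring V))"
  using assms by unfold_locales (auto intro: carrier_mpoly_ring_closed var_in_carrier)

lemma mpoly_max_ideal_sum_var_mult:
  fixes f :: "('v, 'k::field) mpoly"
  assumes "finite V" "f \<in> mpoly_max_ideal V"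
  shows "\<exists>g. (\<forall>v\<in>V. g v \<in> carrier (mpoly_ring V)) \<and> f = (\<Sum>v\<in>V. var v * g v)"
proof -
  let ?S = "mpoly_ring V :: ('v, 'k) mpoly ring"
  interpret S: cring ?S by (rule cring_mpoly_ring)
  let ?Q = "{t :: 'v \<Rightarrow>\<^sub>0 nat. \<exists>v\<in>V. lookup t v > 0}"
  have "mpoly_max_ideal V \<subseteq> {p \<in> carrier ?S. keys p \<subseteq> ?Q}"
    unfolding mpoly_max_ideal_def
  proof (rule S.genideal_minimal)
    show "ideal {p \<in> carrier ?S. keys p \<subseteq> ?Q} ?S"
      by (rule ideal_of_monomials) (auto simp: lookup_add)
    show "var ` V \<subseteq> {p \<in> carrier ?S. keys p \<subseteq> ?Q}"
    proof (rule image_subsetI)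
      fix v assume v: "v \<in> V"
      then have "keys (var v :: ('v, 'k) mpoly) \<subseteq> ?Q"
        by (auto simp: var_def intro!: bexI[of _ v])
      then show "var v \<in> {p \<in> carrier ?S. keys p \<subseteq> ?Q}" using var_in_carrier[OF v] by blast
    qed
  qed
  then have "f \<in> carrier ?S" "\<And>t. t \<in> keys f \<Longrightarrow> \<exists>v\<in>V. lookup t v > 0" using assms(2) by auto
  then show ?thesis using sum_var_mult_of_keys[OF assms(1)] by blast
qed

text \<open>
  The ideals \<open>I + (f\<^sub>1, \<dots>, f\<^sub>j)\<close> for a regular sequence \<open>f\<close> on the quotient play the part of \<open>J\<close>:
  each step raises the degree of a nonzero Koszul homology class by one, and there is none above
  \<open>card V\<close>.
\<close>

lemma depth_le_of_nonzero_homology: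
  fixes I :: "('v, 'k::field) mpoly set"
  assumes I: "ideal I (mpoly_ring V)" and V: "finite V" "inj_on rank V"
    and nz: "koszul.nonzero_homology rank V var (carrier (mpoly_ring V)) I i"
  shows "depth (mpoly_ring V) (mpoly_max_ideal V) (quotient_module (mpoly_ring V) I) \<le> enat (card V - i)"
proof -
  let ?S = "mpoly_ring V :: ('v, 'k) mpoly ring"
  let ?M = "quotient_module ?S I"
  interpret S: cring ?S by (rule cring_mpoly_ring)
  interpret I: ideal I ?S by (rule I)
  interpret M: module ?S ?M by (rule S.module_quotient_module[OF I])
  interpret K: koszul rank V "var :: 'v \<Rightarrow> ('v, 'k) mpoly" "carrier ?S"
    by (rule koszul_mpoly_ring[OF V])
  note hom = S.rcos_module_hom[OF I]
  have add: "I +>\<^bsub>?S\<^esub> (a + b) = (I +>\<^bsub>?S\<^esub> a) \<oplus>\<^bsub>?M\<^esub> (I +>\<^bsub>?S\<^esub> b)"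
    if "a \<in> carrier ?S" "b \<in> carrier ?S" for a b
    using module_homD(2)[OF hom(1)] that by (simp add: self_module_def)
  have smult: "I +>\<^bsub>?S\<^esub> (a * b) = a \<odot>\<^bsub>?M\<^esub> (I +>\<^bsub>?S\<^esub> b)"
    if "a \<in> carrier ?S" "b \<in> carrier ?S" for a b
    using module_homD(3)[OF hom(1)] that by (simp add: self_module_def)
  have zero: "I +>\<^bsub>?S\<^esub> p = \<zero>\<^bsub>?M\<^esub> \<longleftrightarrow> p \<in> I" if "p \<in> carrier ?S" for p
    unfolding hom(3) using that by (metis I.a_rcos_const I.a_rcos_self)
  have "length fs \<le> card V - i"
    if reg: "regular_sequence ?S ?M fs" and fsJ: "set fs \<subseteq> mpoly_max_ideal V" for fs
  proof -
    have fs: "set fs \<subseteq> carrier ?S" using reg by (simp add: regular_sequence_def)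
    have take: "set (take j fs) \<subseteq> carrier ?S" for j using fs set_take_subset by fast
    define J where "J j = {p \<in> carrier ?S. I +>\<^bsub>?S\<^esub> p \<in> list_mult_module ?M (take j fs)}" for j
    have "i + length fs \<le> card V"
    proof (rule K.nonzero_homology_add_length_le[where J = J and f = "\<lambda>j. fs ! j"])
      fix j
      show "K.is_ideal (J j)"
        unfolding K.is_ideal_def
      proof (intro conjI ballI)
        have "I +>\<^bsub>?S\<^esub> 0 = \<zero>\<^bsub>?M\<^esub>" using zero[OF K.zero_R] I.zero_closed by simp
        then show "0 \<in> J j"
          using M.zero_in_list_mult_module[OF take] K.zero_R by (simp add: J_def)
        show "a + b \<in> J j" if "a \<in> J j" "b \<in> J j" for a b
          using that M.list_mult_module_add[OF take] by (auto simp: J_def add K.add_R)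
        show "a * b \<in> J j" if "a \<in> carrier ?S" "b \<in> J j" for a b
          using that M.list_mult_module_smult[OF take] by (auto simp: J_def smult K.mult_R)
      qed
    next
      fix j assume "j < length fs"
      then show "\<exists>g. (\<forall>v\<in>V. g v \<in> carrier ?S) \<and> fs ! j = (\<Sum>v\<in>V. var v * g v)"
        using fsJ by (intro mpoly_max_ideal_sum_var_mult[OF V(1)]) auto
    next
      fix j a assume j: "j < length fs" and a: "a \<in> carrier ?S" "fs ! j * a \<in> J j"
      have fj: "fs ! j \<in> carrier ?S" using fs j by auto
      have "fs ! j \<odot>\<^bsub>?M\<^esub> (I +>\<^bsub>?S\<^esub> a) \<in> list_mult_module ?M (take j fs)"
        using a(2) by (simp add: J_def smult[OF fj a(1)])
      moreover have "I +>\<^bsub>?S\<^esub> a \<in> carrier ?M" using hom(2) a(1) by blast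
      ultimately have "I +>\<^bsub>?S\<^esub> a \<in> list_mult_module ?M (take j fs)"
        using reg j unfolding regular_sequence_def by blast
      then show "a \<in> J j" using a(1) by (simp add: J_def)
    next
      fix j assume j: "j < length fs"
      have fj: "fs ! j \<in> carrier ?S" using fs j by auto
      have iff: "p \<in> J (Suc j) \<longleftrightarrow> (\<exists>a\<in>carrier ?S. \<exists>b\<in>carrier ?S. p = a + fs ! j * b \<and>
          I +>\<^bsub>?S\<^esub> a \<in> list_mult_module ?M (take j fs))" if p: "p \<in> carrier ?S" for p
        using S.list_mult_quotient_take_Suc[OF I fs j p] p by (simp add: J_def)
      show "J (Suc j) = {a + fs ! j * b |a b. a \<in> J j \<and> b \<in> carrier ?S}"
      proof (intro equalityI subsetI)
        fix p assume p: "p \<in> J (Suc j)"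
        then have "p \<in> carrier ?S" by (simp add: J_def)
        then show "p \<in> {a + fs ! j * b |a b. a \<in> J j \<and> b \<in> carrier ?S}"
          using iff p unfolding J_def by blast
      next
        fix p assume "p \<in> {a + fs ! j * b |a b. a \<in> J j \<and> b \<in> carrier ?S}"
        then obtain a b where ab: "p = a + fs ! j * b" "a \<in> J j" "b \<in> carrier ?S" by blast
        then have ac: "a \<in> carrier ?S" "I +>\<^bsub>?S\<^esub> a \<in> list_mult_module ?M (take j fs)"
          by (auto simp: J_def)
        then have "p \<in> carrier ?S" using ab fj by (auto intro: K.add_R K.mult_R)
        then show "p \<in> J (Suc j)" using iff ab ac by blast
      qed
    next
      have "J 0 = I"
        using zero I.a_subset by (auto simp: J_def M.list_mult_module_Nil)
      then show "K.nonzero_homology (J 0) i" using nz by simp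
    qed
    then show ?thesis by simp
  qed
  then show ?thesis unfolding depth_def by (auto intro!: Sup_least)
qed

section \<open>The neighborhood ideal of the strong ladder\<close>

primrec column :: "ladder_vertex \<Rightarrow> nat" where
  "column (X i) = i"
| "column (Y i) = i"

text \<open>
  The two vertices of a column are consecutive in this order.  This determines the relative sign of
  two exterior monomials that differ by exchanging them.
\<close>

primrec ladder_rank :: "ladder_vertex \<Rightarrow> nat" where
  "ladder_rank (X i) = 2 * i"
| "ladder_rank (Y i) = 2 * i + 1"

text \<open>
  The set \<open>s\<close> lists the columns in which \<open>Y\<close> is taken instead of \<open>X\<close>.
\<close>

definition pick :: "nat set \<Rightarrow> nat \<Rightarrow> ladder_vertex" where
  "pick s i = (if i \<in> s then Y i else X i)"

definition chosen_columns :: "nat \<Rightarrow> nat set" where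
  "chosen_columns r = {i \<in> {1..r}. i mod 3 = 1}"

abbreviation (input) ladder_ideal :: "nat \<Rightarrow> (ladder_vertex, 'k::field) mpoly set" where
  "ladder_ideal r \<equiv> neighborhood_ideal (strong_ladder_verts r) (strong_ladder_edges r) (\<lambda>v. 2)"

definition exponent :: "'v set \<Rightarrow> 'v \<Rightarrow>\<^sub>0 nat" where
  "exponent B = (\<Sum>v\<in>B. monomial v 1)"

lemma lookup_exponent: "finite B \<Longrightarrow> lookup (exponent B) v = (if v \<in> B then 1 else 0)"
  by (simp add: exponent_def lookup_sum lookup_single when_def)

lemma prod_var: "finite B \<Longrightarrow> (\<Prod>v\<in>B. var v) = (monomial (exponent B) 1 :: ('v, 'k::field) mpoly)"
  by (induction B rule: finite_induct) (simp_all add: exponent_def var_def mult_single)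

lemma column_pick [simp]: "column (pick s i) = i"
  by (simp add: pick_def)

lemma mem_strong_ladder_verts: "v \<in> strong_ladder_verts r \<longleftrightarrow> column v \<in> {1..r}"
  by (cases v) (auto simp: strong_ladder_verts_def)

lemma finite_strong_ladder_verts: "finite (strong_ladder_verts r)"
  by (simp add: strong_ladder_verts_def)

lemma card_strong_ladder_verts: "card (strong_ladder_verts r) = 2 * r"
  unfolding strong_ladder_verts_def
  by (subst card_Un_disjoint) (auto simp: card_image inj_on_def)

lemma inj_ladder_rank: "inj_on ladder_rank A"
proof (rule inj_onI)
  fix v w assume "ladder_rank v = ladder_rank w"
  then show "v = w" by (cases v; cases w) (simp_all, presburger+)
qed

lemma edge_of_consecutive_columns:
  assumes "column u \<in> {1..<r}" "column w = column u + 1"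
  shows "{u, w} \<in> strong_ladder_edges r"
proof -
  let ?i = "column u"
  have "{u, w} \<in> {{X ?i, X (?i + 1)}, {X ?i, Y (?i + 1)}, {Y ?i, Y (?i + 1)}, {Y ?i, X (?i + 1)}}"
    using assms(2) by (cases u; cases w) simp_all
  then show ?thesis
    unfolding strong_ladder_edges_def using assms(1) by (intro UnI1 UN_I[of "column u"])
qed

lemma edge_of_equal_columns:
  assumes "column u \<in> {1..r}" "column w = column u" "w \<noteq> u"
  shows "{u, w} \<in> strong_ladder_edges r"
proof -
  have "{u, w} = {X (column u), Y (column u)}" using assms(2,3) by (cases u; cases w) auto
  then show ?thesis
    unfolding strong_ladder_edges_def using assms(1) by (intro UnI2 CollectI exI[of _ "column u"] conjI)
qed

lemma columns_of_edge:
  assumes "{u, w} \<in> strong_ladder_edges r"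
  shows "column u \<le> column w + 1 \<and> column w \<le> column u + 1"
proof -
  consider i where "{u, w} \<in> {{X i, X (i + 1)}, {X i, Y (i + 1)}, {Y i, Y (i + 1)}, {Y i, X (i + 1)}}"
    | i where "{u, w} = {X i, Y i}"
    using assms unfolding strong_ladder_edges_def by blast
  then show ?thesis
  proof cases
    case 1
    then show ?thesis unfolding insert_iff empty_iff doubleton_eq_iff by (elim disjE conjE) simp_all
  next
    case 2
    then show ?thesis unfolding doubleton_eq_iff by (elim disjE conjE) simp_all
  qed
qed

lemma mem_closed_neighborhood:
  assumes "u \<in> strong_ladder_verts r" "w \<in> strong_ladder_verts r"
  shows "w \<in> closed_neighborhood (strong_ladder_verts r) (strong_ladder_edges r) u \<longleftrightarrow>
    column u \<le> column w + 1 \<and> column w \<le> column u + 1"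
proof
  assume "w \<in> closed_neighborhood (strong_ladder_verts r) (strong_ladder_edges r) u"
  then have "w = u \<or> {u, w} \<in> strong_ladder_edges r" by (simp add: closed_neighborhood_def)
  then show "column u \<le> column w + 1 \<and> column w \<le> column u + 1"
    using columns_of_edge[of u w r] by auto
next
  assume "column u \<le> column w + 1 \<and> column w \<le> column u + 1"
  then consider "column w = column u + 1" | "column u = column w + 1" | "column w = column u"
    by linarith
  then have "w = u \<or> {u, w} \<in> strong_ladder_edges r"
  proof cases
    case 1
    then show ?thesis
      using edge_of_consecutive_columns[of u r w] assms by (simp add: mem_strong_ladder_verts)
  next
    case 2
    then show ?thesis
      using edge_of_consecutive_columns[of w r u] assms
      by (simp add: mem_strong_ladder_verts insert_commute)
  next
    case 3
    then show ?thesis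
      using edge_of_equal_columns[of u r w] assms by (auto simp: mem_strong_ladder_verts)
  qed
  then show "w \<in> closed_neighborhood (strong_ladder_verts r) (strong_ladder_edges r) u"
    using assms(2) by (simp add: closed_neighborhood_def)
qed

text \<open>
  Two vertices in the closed neighborhood of \<open>v\<close> are each at most one column away from \<open>v\<close>.
\<close>

lemma ladder_ideal_generators_subset:
  "{\<Prod>w\<in>W. var w |W. \<exists>v\<in>strong_ladder_verts r.
      W \<subseteq> closed_neighborhood (strong_ladder_verts r) (strong_ladder_edges r) v \<and> card W = 2}
    \<subseteq> {p \<in> carrier (mpoly_ring (strong_ladder_verts r) :: (ladder_vertex, 'k::field) mpoly ring).
        keys p \<subseteq> {t. \<exists>a b. a \<noteq> b \<and> column a \<le> column b + 2 \<and> column b \<le> column a + 2 \<and>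
          lookup t a > 0 \<and> lookup t b > 0}}" (is "_ \<subseteq> ?I")
proof
  fix p :: "(ladder_vertex, 'k) mpoly"
  assume "p \<in> {\<Prod>w\<in>W. var w |W. \<exists>v\<in>strong_ladder_verts r.
      W \<subseteq> closed_neighborhood (strong_ladder_verts r) (strong_ladder_edges r) v \<and> card W = 2}"
  then obtain W v where p: "p = (\<Prod>w\<in>W. var w)" and v: "v \<in> strong_ladder_verts r"
    and W: "W \<subseteq> closed_neighborhood (strong_ladder_verts r) (strong_ladder_edges r) v" "card W = 2"
    by blast
  obtain a b where ab: "W = {a, b}" "a \<noteq> b" using W(2) by (auto simp: card_2_iff)
  have nb: "column v \<le> column w + 1 \<and> column w \<le> column v + 1 \<and> w \<in> strong_ladder_verts r" if "w \<in> W" for w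
    using W(1) that mem_closed_neighborhood[OF v, of w] by (auto simp: closed_neighborhood_def)
  have p': "p = monomial (exponent W) 1" unfolding p by (rule prod_var) (simp add: ab)
  have "keys (exponent W) \<subseteq> W"
    using lookup_exponent[of W] by (auto simp: in_keys_iff ab split: if_splits)
  then have "p \<in> carrier (mpoly_ring (strong_ladder_verts r))"
    unfolding p' using nb by (intro monomial_in_carrier) blast
  moreover have "column a \<le> column b + 2 \<and> column b \<le> column a + 2"
    using nb[of a] nb[of b] by (simp add: ab)
  moreover have "lookup (exponent W) a > 0" "lookup (exponent W) b > 0"
    by (simp_all add: lookup_exponent ab)
  ultimately show "p \<in> ?I" using ab(2) unfolding p' by auto
qed

lemma ideal_ladder_ideal:
  "ideal (ladder_ideal r :: (ladder_vertex, 'k::field) mpoly set) (mpoly_ring (strong_ladder_verts r))"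
proof -
  interpret S: cring "mpoly_ring (strong_ladder_verts r) :: (ladder_vertex, 'k) mpoly ring"
    by (rule cring_mpoly_ring)
  show ?thesis
    unfolding neighborhood_ideal_def
    by (rule S.genideal_ideal) (use ladder_ideal_generators_subset in blast)
qed

lemma close_columns_of_keys_ladder_ideal:
  assumes "p \<in> ladder_ideal r" "t \<in> keys p"
  shows "\<exists>a b. a \<noteq> b \<and> column a \<le> column b + 2 \<and> column b \<le> column a + 2 \<and>
    lookup t a > 0 \<and> lookup t b > 0"
proof -
  let ?S = "mpoly_ring (strong_ladder_verts r) :: (ladder_vertex, 'a) mpoly ring"
  let ?Q = "{t. \<exists>a b. a \<noteq> b \<and> column a \<le> column b + 2 \<and> column b \<le> column a + 2 \<and>
    lookup t a > 0 \<and> lookup t b > 0}"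
  interpret S: cring ?S by (rule cring_mpoly_ring)
  have "ideal {p \<in> carrier ?S. keys p \<subseteq> ?Q} ?S"
  proof (rule ideal_of_monomials)
    fix s t :: "ladder_vertex \<Rightarrow>\<^sub>0 nat"
    assume "t \<in> ?Q"
    moreover have "lookup t a > 0 \<Longrightarrow> lookup (s + t) a > 0" for a by (simp add: lookup_add)
    ultimately show "s + t \<in> ?Q" by blast
  qed
  then have "ladder_ideal r \<subseteq> {p \<in> carrier ?S. keys p \<subseteq> ?Q}"
    unfolding neighborhood_ideal_def using ladder_ideal_generators_subset by (rule S.genideal_minimal)
  then show ?thesis using assms by blast
qed

lemma var_mult_prod_in_ladder_ideal:
  assumes A: "finite A" "A \<subseteq> strong_ladder_verts r" "a \<in> A" and v: "v \<in> strong_ladder_verts r" "v \<noteq> a"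
    and u: "u \<in> strong_ladder_verts r" "column u \<le> column a + 1" "column a \<le> column u + 1"
      "column u \<le> column v + 1" "column v \<le> column u + 1"
  shows "var v * (\<Prod>w\<in>A. var w) \<in> (ladder_ideal r :: (ladder_vertex, 'k::field) mpoly set)"
proof -
  let ?V = "strong_ladder_verts r"
  let ?S = "mpoly_ring ?V :: (ladder_vertex, 'k) mpoly ring"
  interpret S: cring ?S by (rule cring_mpoly_ring)
  interpret I: ideal "ladder_ideal r" ?S by (rule ideal_ladder_ideal)
  let ?G = "{\<Prod>w\<in>W. var w |W. \<exists>v\<in>?V. W \<subseteq> closed_neighborhood ?V (strong_ladder_edges r) v \<and> card W = 2}
    :: (ladder_vertex, 'k) mpoly set"
  have "{v, a} \<subseteq> closed_neighborhood ?V (strong_ladder_edges r) u"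
    using assms mem_closed_neighborhood[OF u(1)] by auto
  then have "(\<Prod>w\<in>{v, a}. var w) \<in> ?G"
    using u(1) v(2) by (intro CollectI exI[of _ "{v, a}"]) auto
  moreover have "?G \<subseteq> ladder_ideal r"
    unfolding neighborhood_ideal_def by (rule S.genideal_self) (use ladder_ideal_generators_subset in blast)
  ultimately have "var v * var a \<in> (ladder_ideal r :: (ladder_vertex, 'k) mpoly set)" using v(2) by auto
  moreover have "(\<Prod>w\<in>A - {a}. var w) \<in> carrier ?S"
    using A by (subst prod_var) (auto intro!: monomial_in_carrier simp: in_keys_iff lookup_exponent split: if_splits)
  ultimately have "(var v * var a) * (\<Prod>w\<in>A - {a}. var w) \<in> (ladder_ideal r :: (ladder_vertex, 'k) mpoly set)"
    using I.I_r_closed by simp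
  then show ?thesis using A by (simp add: prod.remove mult.assoc)
qed

lemma finite_chosen_columns: "finite (chosen_columns r)"
  by (simp add: chosen_columns_def)

lemma pick_in_verts: "pick s ` chosen_columns r \<subseteq> strong_ladder_verts r"
  by (auto simp: mem_strong_ladder_verts chosen_columns_def)

lemma inj_on_pick: "inj_on (pick s) A"
  by (metis column_pick inj_onI)

text \<open>
  The chosen columns are \<open>1, 4, 7, \<dots>\<close>.  A vertex in column \<open>3 k + 1\<close>, \<open>3 k + 2\<close> or \<open>3 k + 3\<close> lies in
  a closed neighborhood that contains the vertex picked in column \<open>3 k + 1\<close> as well.
\<close>

lemma var_mult_pick_in_ladder_ideal:
  assumes "v \<in> strong_ladder_verts r" "v \<notin> pick s ` chosen_columns r"
  shows "var v * (\<Prod>w\<in>pick s ` chosen_columns r. var w) \<in> ladder_ideal r"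
proof -
  let ?c = "column v"
  have c: "1 \<le> ?c" "?c \<le> r" using assms(1) by (auto simp: mem_strong_ladder_verts)
  have "\<exists>k. ?c = 3 * k + 1 \<or> ?c = 3 * k + 2 \<or> ?c = 3 * k + 3" using c(1) by presburger
  then obtain k where k: "?c = 3 * k + 1 \<or> ?c = 3 * k + 2 \<or> ?c = 3 * k + 3" by blast
  define i where "i = 3 * k + 1"
  \<comment> \<open>\<open>X j\<close> is the center of the common closed neighborhood.\<close>
  define j where "j = (if ?c = 3 * k + 3 then 3 * k + 2 else 3 * k + 1)"
  have "(3 * k + 1) mod 3 = 1" by presburger
  moreover have "3 * k + 1 \<le> r" using k c(2) by linarith
  ultimately have i: "i \<in> chosen_columns r" by (simp add: chosen_columns_def i_def)
  have j: "1 \<le> j" "j \<le> r" "j \<le> i + 1" "i \<le> j + 1" "j \<le> ?c + 1" "?c \<le> j + 1"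
    using k c(2) unfolding i_def j_def by (simp_all split: if_split, linarith+)
  show ?thesis
  proof (rule var_mult_prod_in_ladder_ideal)
    show "finite (pick s ` chosen_columns r)" using finite_chosen_columns by simp
    show "pick s ` chosen_columns r \<subseteq> strong_ladder_verts r" by (rule pick_in_verts)
    show "pick s i \<in> pick s ` chosen_columns r" using i by simp
    then show "v \<noteq> pick s i" using assms(2) by blast
    show "v \<in> strong_ladder_verts r" by (rule assms(1))
    show "X j \<in> strong_ladder_verts r" using j by (simp add: mem_strong_ladder_verts)
  qed (use j in simp_all)
qed

text \<open>
  Distinct picked vertices are at least three columns apart, so their product is not in the ideal.
\<close>

lemma lookup_ladder_ideal_exponent_pick:
  assumes "p \<in> ladder_ideal r"
  shows "lookup p (exponent (pick s ` chosen_columns r)) = 0"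
proof (rule ccontr)
  let ?B = "pick s ` chosen_columns r"
  assume "lookup p (exponent ?B) \<noteq> 0"
  then obtain a b where ab: "a \<noteq> b" "column a \<le> column b + 2" "column b \<le> column a + 2"
    "lookup (exponent ?B) a > 0" "lookup (exponent ?B) b > 0"
    using close_columns_of_keys_ladder_ideal[OF assms, of "exponent ?B"] by (auto simp: in_keys_iff)
  then have "a \<in> ?B" "b \<in> ?B"
    by (auto simp: lookup_exponent finite_chosen_columns split: if_splits)
  then obtain i j where "a = pick s i" "b = pick s j" "i mod 3 = 1" "j mod 3 = 1"
    by (auto simp: chosen_columns_def)
  moreover from this have "i \<noteq> j" using ab(1) by auto
  ultimately show False using ab(2,3) by simp presburger
qed

lemma card_chosen_columns: "card (chosen_columns r) = nat \<lceil>real r / 3\<rceil>"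
proof -
  have "chosen_columns r = (\<lambda>k. 3 * k + 1) ` {..<(r + 2) div 3}"
  proof (intro equalityI subsetI)
    fix i assume "i \<in> chosen_columns r"
    then have "i = 3 * (i div 3) + 1" "i div 3 < (r + 2) div 3"
      by (auto simp: chosen_columns_def) presburger+
    then show "i \<in> (\<lambda>k. 3 * k + 1) ` {..<(r + 2) div 3}" by blast
  next
    fix i assume "i \<in> (\<lambda>k. 3 * k + 1) ` {..<(r + 2) div 3}"
    then obtain k where k: "i = 3 * k + 1" "k < (r + 2) div 3" by blast
    then have "3 * k + 1 \<le> r" by linarith
    moreover have "(3 * k + 1) mod 3 = 1" by presburger
    ultimately show "i \<in> chosen_columns r" by (simp add: chosen_columns_def k(1))
  qed
  then have "card (chosen_columns r) = (r + 2) div 3"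
    by (simp add: card_image inj_on_def)
  moreover have "\<lceil>real r / 3\<rceil> = int ((r + 2) div 3)"
  proof (rule ceiling_unique)
    have "3 * ((r + 2) div 3) < r + 3" "r \<le> 3 * ((r + 2) div 3)" by linarith+
    then have "real (3 * ((r + 2) div 3)) < real (r + 3)" "real r \<le> real (3 * ((r + 2) div 3))"
      by (simp_all only: of_nat_less_iff of_nat_le_iff)
    then show "real_of_int (int ((r + 2) div 3)) - 1 < real r / 3"
      "real r / 3 \<le> real_of_int (int ((r + 2) div 3))" by simp_all
  qed
  ultimately show ?thesis by simp
qed

section \<open>A nonzero Koszul homology class of the ladder\<close>

lemma sum_Pow_alternating_eq_0:
  fixes F :: "'b set \<Rightarrow> 'a::ab_group_add"
  assumes "finite C" "i \<in> C" "\<And>s. s \<subseteq> C - {i} \<Longrightarrow> F (insert i s) = - F s"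
  shows "(\<Sum>s\<in>Pow C. F s) = 0"
proof -
  let ?P = "Pow (C - {i})"
  have "Pow C = ?P \<union> insert i ` ?P" using Pow_insert[of i "C - {i}"] assms(2) by (simp add: insert_absorb)
  moreover have "?P \<inter> insert i ` ?P = {}" by auto
  moreover have "finite ?P" using assms(1) by simp
  ultimately have "(\<Sum>s\<in>Pow C. F s) = (\<Sum>s\<in>?P. F s) + (\<Sum>s\<in>insert i ` ?P. F s)"
    by (simp add: sum.union_disjoint)
  also have "(\<Sum>s\<in>insert i ` ?P. F s) = (\<Sum>s\<in>?P. F (insert i s))"
    by (subst sum.reindex) (auto simp: inj_on_def)
  also have "\<dots> = (\<Sum>s\<in>?P. - F s)"
    by (rule sum.cong) (use assms(3) in auto)
  finally show ?thesis by (simp add: sum_negf)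
qed

lemma keys_exponent: "finite B \<Longrightarrow> keys (exponent B) = B"
  by (auto simp: in_keys_iff lookup_exponent split: if_splits)

lemma koszul_strong_ladder:
  "koszul ladder_rank (strong_ladder_verts r) (var :: ladder_vertex \<Rightarrow> (ladder_vertex, 'k::field) mpoly)
    (carrier (mpoly_ring (strong_ladder_verts r)))"
  by (rule koszul_mpoly_ring[OF finite_strong_ladder_verts inj_ladder_rank])

text \<open>
  \<open>F s\<close> is the contribution of the picked vertex of column \<open>i\<close> to the coefficient, at the product of
  the picked vertices, of the boundary of \<open>u\<close> on the complement of these vertices.  Both sides
  involve the same coefficient of \<open>u\<close>, on the complement of the vertices picked in the other
  columns, and the signs differ because \<open>X i\<close> precedes \<open>Y i\<close> with no vertex in between.
\<close>

lemma koszul_boundary_twin_flip: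
  fixes u :: "ladder_vertex set \<Rightarrow> (ladder_vertex, 'k::field) mpoly"
  assumes i: "i \<in> chosen_columns r" and s: "s \<subseteq> chosen_columns r - {i}"
  defines "V \<equiv> strong_ladder_verts r" and "B \<equiv> \<lambda>s. pick s ` chosen_columns r"
  defines "F \<equiv> \<lambda>s. lookup (koszul.sign ladder_rank (pick s i) (V - B s) * var (pick s i) *
      u (insert (pick s i) (V - B s))) (exponent (B s))"
  shows "F (insert i s) = - F s"
proof -
  interpret K: koszul ladder_rank V "var :: ladder_vertex \<Rightarrow> (ladder_vertex, 'k) mpoly" "carrier (mpoly_ring V)"
    unfolding V_def by (rule koszul_strong_ladder)
  define B0 where "B0 = pick s ` (chosen_columns r - {i})"
  define D where "D = V - B0 - {X i, Y i}"
  have si: "i \<notin> s" using s by blast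
  have B0': "pick (insert i s) ` (chosen_columns r - {i}) = B0"
    unfolding B0_def by (rule image_cong) (auto simp: pick_def)
  have C: "chosen_columns r = insert i (chosen_columns r - {i})" using i by blast
  have p: "pick s i = X i" "pick (insert i s) i = Y i" using si by (simp_all add: pick_def)
  have Bs: "B s = insert (X i) B0"
    using arg_cong[OF C, of "image (pick s)"] unfolding B_def image_insert p B0_def[symmetric] .
  have Bis: "B (insert i s) = insert (Y i) B0"
    using arg_cong[OF C, of "image (pick (insert i s))"] unfolding B_def image_insert p B0' .
  note B = Bs Bis
  have col: "column v \<noteq> i" if "v \<in> B0" for v using that by (auto simp: B0_def)
  have nB0: "X i \<notin> B0" "Y i \<notin> B0" using col[of "X i"] col[of "Y i"] by auto
  have XY: "X i \<in> V" "Y i \<in> V" using i by (auto simp: V_def mem_strong_ladder_verts chosen_columns_def)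
  have T: "V - B s = insert (Y i) D" "V - B (insert i s) = insert (X i) D"
    unfolding B D_def using nB0 XY by auto
  have DV: "D \<subseteq> V" and nD: "X i \<notin> D" "Y i \<notin> D" by (auto simp: D_def)
  have fin: "finite B0" by (simp add: B0_def finite_chosen_columns)
  have ex: "exponent (B s) = monomial (X i) 1 + exponent B0"
    "exponent (B (insert i s)) = monomial (Y i) 1 + exponent B0"
    unfolding B using fin nB0 by (simp_all add: exponent_def)
  have look: "lookup (a * var v * q) (monomial v 1 + t) = lookup (a * q) t"
    for a q :: "(ladder_vertex, 'k) mpoly" and v t
    using lookup_var_mult[of v "a * q" t] by (simp only: mult_ac)
  have "{t \<in> D. ladder_rank t < ladder_rank (Y i)} = {t \<in> D. ladder_rank t < ladder_rank (X i)}"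
  proof -
    have "ladder_rank t \<noteq> 2 * i" if "t \<in> D" for t
    proof
      assume "ladder_rank t = 2 * i"
      then have "t = X i" using inj_onD[OF inj_ladder_rank, of t "X i" UNIV] by simp
      then show False using that nD(1) by simp
    qed
    then show ?thesis by (auto simp: less_Suc_eq)
  qed
  then have "K.sign (Y i) D = K.sign (X i) D" by (simp only: K.sign_def)
  moreover have "K.sign (Y i) (insert (X i) D) = - K.sign (Y i) D"
    by (rule K.sign_insert_gt[OF DV nD(1)]) simp
  moreover have "K.sign (X i) (insert (Y i) D) = K.sign (X i) D"
    by (rule K.sign_insert_le) simp
  ultimately have sgn: "K.sign (Y i) (insert (X i) D) = - K.sign (X i) (insert (Y i) D)" by simp
  show ?thesis
    unfolding F_def p ex look T sgn by (simp add: insert_commute[of "X i" "Y i"])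
qed

text \<open>
  The cycle \<open>z\<close> is supported on the complement of the set of all picked \<open>X i\<close>, with the product \<open>w\<close>
  of these as its coefficient.  To see that it is not a boundary modulo the ideal, add up over all
  \<open>s\<close> the coefficient, at the product of the vertices picked for \<open>s\<close>, of the value of a chain on the
  complement of these vertices.  Elements of the ideal do not contribute; for a boundary the terms
  cancel in pairs that differ by a twin; for \<open>z\<close> only \<open>s = {}\<close> contributes, namely 1.
\<close>

lemma nonzero_homology_ladder_ideal:
  fixes r :: nat
  defines "V \<equiv> strong_ladder_verts r"
  shows "koszul.nonzero_homology ladder_rank V (var :: ladder_vertex \<Rightarrow> (ladder_vertex, 'k::field) mpoly)
    (carrier (mpoly_ring V)) (ladder_ideal r) (card V - card (chosen_columns r))"
proof -
  let ?S = "mpoly_ring V :: (ladder_vertex, 'k) mpoly ring"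
  let ?C = "chosen_columns r"
  interpret K: koszul ladder_rank V "var :: ladder_vertex \<Rightarrow> (ladder_vertex, 'k) mpoly" "carrier ?S"
    unfolding V_def by (rule koszul_strong_ladder)
  interpret S: cring ?S by (rule cring_mpoly_ring)
  interpret I: ideal "ladder_ideal r" ?S unfolding V_def by (rule ideal_ladder_ideal)
  define B where "B s = pick s ` ?C" for s
  have BV: "B s \<subseteq> V" for s unfolding B_def V_def by (rule pick_in_verts)
  have finB: "finite (B s)" for s by (simp add: B_def finite_chosen_columns)
  have cardB: "card (B s) = card ?C" for s unfolding B_def by (rule card_image[OF inj_on_pick])
  define w :: "(ladder_vertex, 'k) mpoly" where "w = (\<Prod>v\<in>B {}. var v)"
  have w: "w = monomial (exponent (B {})) 1" unfolding w_def by (rule prod_var[OF finB])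
  have "keys (exponent (B {})) \<subseteq> V"
    unfolding keys_exponent[OF finB] by (rule BV)
  then have wS: "w \<in> carrier ?S" unfolding w by (rule monomial_in_carrier)
  define z where "z T = (if T = V - B {} then w else 0)" for T
  have NI0: "0 \<in> (ladder_ideal r :: (ladder_vertex, 'k) mpoly set)" using I.zero_closed by simp
  have K_ideal: "K.is_ideal (ladder_ideal r)"
    unfolding K.is_ideal_def using NI0 I.a_closed I.I_l_closed by simp
  show ?thesis
    unfolding K.nonzero_homology_def
  proof (intro exI[of _ z] conjI allI impI)
    show "range z \<subseteq> carrier ?S" using wS K.zero_R by (auto simp: z_def)
  next
    fix T :: "ladder_vertex set" assume "card T \<noteq> card V - card ?C"
    then show "z T = 0"
      using card_Diff_subset[OF finB BV, of "{}"] by (auto simp: z_def cardB)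
  next
    fix T :: "ladder_vertex set" assume T: "T \<subseteq> V"
    show "K.boundary z T \<in> ladder_ideal r"
      unfolding K.boundary_def
    proof (rule K.is_ideal_sum[OF K_ideal])
      fix v assume v: "v \<in> V - T"
      show "K.sign v T * var v * z (insert v T) \<in> ladder_ideal r"
      proof (cases "insert v T = V - B {}")
        case True
        then have "v \<in> V" "v \<notin> B {}" by auto
        then have "var v * w \<in> ladder_ideal r"
          unfolding w_def B_def V_def by (rule var_mult_pick_in_ladder_ideal)
        then show ?thesis
          using True K_ideal K.sign_R[of v T] by (simp add: z_def K.is_ideal_def mult.assoc)
      qed (simp add: z_def NI0)
    qed
  next
    fix u :: "ladder_vertex set \<Rightarrow> (ladder_vertex, 'k) mpoly"
    assume u: "range u \<subseteq> carrier ?S"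
    show "\<exists>T\<subseteq>V. z T - K.boundary u T \<notin> ladder_ideal r"
    proof (rule ccontr)
      assume "\<not> ?thesis"
      then have *: "z (V - B s) - K.boundary u (V - B s) \<in> ladder_ideal r" for s by blast
      let ?F = "\<lambda>s i. lookup (K.sign (pick s i) (V - B s) * var (pick s i) *
          u (insert (pick s i) (V - B s))) (exponent (B s))"
      have "lookup (K.boundary u (V - B s)) (exponent (B s)) = (\<Sum>i\<in>?C. ?F s i)" for s
      proof -
        have "V - (V - B s) = pick s ` ?C" using BV[of s] by (auto simp: B_def)
        then show ?thesis
          unfolding K.boundary_def lookup_sum by (simp add: sum.reindex[OF inj_on_pick])
      qed
      then have eq: "lookup (z (V - B s)) (exponent (B s)) = (\<Sum>i\<in>?C. ?F s i)" for s
        using lookup_ladder_ideal_exponent_pick[OF *[of s], of s, folded B_def]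
        unfolding lookup_minus by (simp only: right_minus_eq)
      have "(\<Sum>s\<in>Pow ?C. \<Sum>i\<in>?C. ?F s i) = (\<Sum>i\<in>?C. \<Sum>s\<in>Pow ?C. ?F s i)"
        by (rule sum.swap)
      also have "\<dots> = 0"
      proof (rule sum.neutral, rule ballI)
        fix i assume i: "i \<in> ?C"
        show "(\<Sum>s\<in>Pow ?C. ?F s i) = 0"
          using koszul_boundary_twin_flip[OF i, of _ u] unfolding V_def B_def
          by (intro sum_Pow_alternating_eq_0[OF finite_chosen_columns i])
      qed
      finally have "(\<Sum>s\<in>Pow ?C. lookup (z (V - B s)) (exponent (B s))) = 0"
        unfolding eq .
      moreover have "lookup (z (V - B s)) (exponent (B s)) = (if s = {} then 1 else 0)"
        if "s \<in> Pow ?C" for s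
      proof (cases "s = {}")
        case True
        then show ?thesis by (simp add: z_def w)
      next
        case False
        then obtain i where i: "i \<in> s" by (auto simp only: ex_in_conv[symmetric])
        then have "i \<in> ?C" by (rule subsetD[OF PowD[OF that]])
        note i this
        then have "Y i \<in> B s" unfolding B_def by (intro image_eqI[of _ _ i]) (simp_all add: pick_def)
        moreover have "Y i \<notin> B {}" by (auto simp: B_def pick_def)
        ultimately have "V - B s \<noteq> V - B {}" using BV[of s] by blast
        then show ?thesis using False by (simp add: z_def)
      qed
      then have "(\<Sum>s\<in>Pow ?C. lookup (z (V - B s)) (exponent (B s))) =
          (\<Sum>s\<in>Pow ?C. if s = {} then 1 else 0)"
        by (rule sum.cong[OF refl])
      moreover have "(\<Sum>s\<in>Pow ?C. if s = {} then 1 else 0 :: 'k) = 1"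
      proof -
        have "finite (Pow ?C)" using finite_chosen_columns by (simp only: finite_Pow_iff)
        then show ?thesis using sum.delta[of "Pow ?C" "{}" "\<lambda>_. 1 :: 'k"] by (simp only: Pow_bottom if_True)
      qed
      ultimately have "(0 :: 'k) = 1" by (simp only:)
      then show False by simp
    qed
  qed
qed

theorem corollary4p13:
  fixes r :: nat
    and S :: "(ladder_vertex, 'k::field) mpoly ring"
    and NI :: "(ladder_vertex, 'k) mpoly set"
  assumes "1 \<le> r"
    and "S = mpoly_ring (strong_ladder_verts r)"
    and "NI = neighborhood_ideal (strong_ladder_verts r) (strong_ladder_edges r) (\<lambda>v. 2)"
  shows "proj_dim TYPE('u) S (quotient_module S NI) \<ge> enat (2 * r - nat \<lceil>real r / 3\<rceil>) \<and>
         depth S (mpoly_max_ideal (strong_ladder_verts r)) (quotient_module S NI)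
           \<le> enat (nat \<lceil>real r / 3\<rceil>)"
proof
  let ?V = "strong_ladder_verts r" and ?C = "chosen_columns r"
  let ?B = "pick {} ` chosen_columns r"
  have cardB: "card ?B = card ?C" by (rule card_image[OF inj_on_pick])
  have finB: "finite ?B" by (simp add: finite_chosen_columns)
  have card_diff: "card (?V - ?B) = 2 * r - nat \<lceil>real r / 3\<rceil>"
    by (simp add: card_Diff_subset[OF finB pick_in_verts] cardB card_strong_ladder_verts card_chosen_columns)
  have "keys (exponent ?B) \<subseteq> ?V"
    unfolding keys_exponent[OF finB] by (rule pick_in_verts)
  then have w: "(\<Prod>v\<in>?B. var v) \<in> carrier S"
    unfolding assms(2) prod_var[OF finB] by (rule monomial_in_carrier)
  have "(\<Prod>v\<in>?B. var v) \<notin> NI"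
    using lookup_ladder_ideal_exponent_pick[of "\<Prod>v\<in>?B. var v :: (ladder_vertex, 'k) mpoly" r "{}"]
    unfolding assms(3) prod_var[OF finB] by auto
  then have "enat (card (?V - ?B)) \<le> proj_dim TYPE('u) S (quotient_module S NI)"
    using w ideal_ladder_ideal var_mult_pick_in_ladder_ideal finite_strong_ladder_verts unfolding assms(2,3)
    by (intro proj_dim_ge_card_annihilating_vars) auto
  then show "enat (2 * r - nat \<lceil>real r / 3\<rceil>) \<le> proj_dim TYPE('u) S (quotient_module S NI)"
    by (simp only: card_diff)
  have "card ?C \<le> card ?V"
    using card_mono[OF finite_strong_ladder_verts pick_in_verts[of "{}" r]] by (simp only: cardB)
  then have "card ?V - (card ?V - card ?C) = nat \<lceil>real r / 3\<rceil>" by (simp add: card_chosen_columns)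
  then show "depth S (mpoly_max_ideal ?V) (quotient_module S NI) \<le> enat (nat \<lceil>real r / 3\<rceil>)"
    using depth_le_of_nonzero_homology[OF ideal_ladder_ideal finite_strong_ladder_verts inj_ladder_rank
        nonzero_homology_ladder_ideal[of r]]
    unfolding assms(2,3) by simp
qed

end
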